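(* For a discrete memoryless two-user multiple access channel with generalized feedback (MAC-GF) with transition probability $p(y,y_{F_1},y_{F_2}|x_1,x_2)$, the capacity region is contained in the region $\mathcal{DB}^{MAC}$, defined as the set (union over all admissible distributions) of all pairs $(R_1,R_2)$ of nonnegative reals for which there exist random variables $(T_1,T_2,X_1,X_2,Y,Y_{F_1},Y_{F_2})$ with $$R_1\le I(X_1;Y,Y_{F_2}|X_2,T_2),$$ $$R_2\le I(X_2;Y,Y_{F_1}|X_1,T_1),$$ $$R_1+R_2\le I(X_1,X_2;Y,Y_{F_1},Y_{F_2}|T_1,T_2),$$ $$R_1+R_2\le I(X_1,X_2;Y),$$ whose joint distribution has the form $$p(t_1,t_2,x_1,x_2,y,y_{F_1},y_{F_2})=p(t_1,t_2,x_1,x_2)\,p(y,y_{F_1},y_{F_2}|x_1,x_2),$$ and which satisfy the dependence balance bound $$I(X_1;X_2|T_1,T_2)\le I(X_1;X_2|Y_{F_1},Y_{F_2},T_1,T_2).$$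
   Context: A discrete memoryless MAC-GF consists of finite input alphabets $\mathcal X_1,\mathcal X_2$, a finite receiver output alphabet $\mathcal Y$, finite feedback alphabets $\mathcal Y_{F_1},\mathcal Y_{F_2}$ (at transmitters 1 and 2), and a transition probability $p(y,y_{F_1},y_{F_2}|x_1,x_2)$, used memorylessly. An $(n,M_1,M_2,P_e)$ code consists of encoding functions $f_{ki}:\{1,\dots,M_k\}\times\mathcal Y_{F_k}^{i-1}\to\mathcal X_k$, $k=1,2$, $i=1,\dots,n$ (so $X_{ki}=f_{ki}(W_k,Y_{F_k}^{i-1})$), and a decoder $g:\mathcal Y^n\to\{1,\dots,M_1\}\times\{1,\dots,M_2\}$. The messages $W_1,W_2$ are independent and uniform on $\{1,\dots,M_1\}$, $\{1,\dots,M_2\}$, and $P_e=\Pr[(\hat W_1,\hat W_2)\ne(W_1,W_2)]$, where $(\hat W_1,\hat W_2)=g(Y^n)$. A pair $(R_1,R_2)$ of nonnegative reals is achievable if for every $\epsilon>0$ and all sufficiently large $n$ there is a code with $R_1\le \log(M_1)/n$, $R_2\le\log(M_2)/n$ and $P_e\le\epsilon$. The capacity region is the closure of the set of achievable pairs. $T_1,T_2$ are auxiliary random variables with arbitrary alphabets. *)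

theory Defs
  imports "HOL-Probability.Probability"
begin

type_synonym ('x1, 'x2, 'y, 'f1, 'f2) mac_gf = "'x1 \<Rightarrow> 'x2 \<Rightarrow> ('y \<times> 'f1 \<times> 'f2) pmf"

text \<open>An encoder takes the time index, the message and the feedback received so far
  (oldest symbol first).\<close>

type_synonym ('f, 'x) encoder = "nat \<Rightarrow> nat \<Rightarrow> 'f list \<Rightarrow> 'x"

primrec channel_outputs ::
  "('x1, 'x2, 'y, 'f1, 'f2) mac_gf \<Rightarrow> ('f1, 'x1) encoder \<Rightarrow> ('f2, 'x2) encoder \<Rightarrow>
    nat \<Rightarrow> nat \<Rightarrow> nat \<Rightarrow> ('y \<times> 'f1 \<times> 'f2) list pmf" where
  "channel_outputs p enc1 enc2 w1 w2 0 = return_pmf []"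
| "channel_outputs p enc1 enc2 w1 w2 (Suc i) =
    bind_pmf (channel_outputs p enc1 enc2 w1 w2 i) (\<lambda>zs.
      map_pmf (\<lambda>z. zs @ [z])
        (p (enc1 (Suc i) w1 (map (\<lambda>(y, u, v). u) zs))
           (enc2 (Suc i) w2 (map (\<lambda>(y, u, v). v) zs))))"

definition messages_and_outputs ::
  "('x1, 'x2, 'y, 'f1, 'f2) mac_gf \<Rightarrow> nat \<Rightarrow> nat \<Rightarrow> nat \<Rightarrow>
    ('f1, 'x1) encoder \<Rightarrow> ('f2, 'x2) encoder \<Rightarrow> ((nat \<times> nat) \<times> ('y \<times> 'f1 \<times> 'f2) list) pmf" where
  "messages_and_outputs p n M1 M2 enc1 enc2 =
    bind_pmf (pair_pmf (pmf_of_set {1..M1}) (pmf_of_set {1..M2})) (\<lambda>(w1, w2).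
      map_pmf (\<lambda>zs. ((w1, w2), zs)) (channel_outputs p enc1 enc2 w1 w2 n))"

definition error_probability ::
  "('x1, 'x2, 'y, 'f1, 'f2) mac_gf \<Rightarrow> nat \<Rightarrow> nat \<Rightarrow> nat \<Rightarrow>
    ('f1, 'x1) encoder \<Rightarrow> ('f2, 'x2) encoder \<Rightarrow> ('y list \<Rightarrow> nat \<times> nat) \<Rightarrow> real" where
  "error_probability p n M1 M2 enc1 enc2 dec =
    measure_pmf.prob (messages_and_outputs p n M1 M2 enc1 enc2)
      {(w, zs). dec (map (\<lambda>(y, u, v). y) zs) \<noteq> w}"

definition is_code ::
  "('x1, 'x2, 'y, 'f1, 'f2) mac_gf \<Rightarrow> nat \<Rightarrow> nat \<Rightarrow> nat \<Rightarrow> real \<Rightarrow>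
    ('f1, 'x1) encoder \<Rightarrow> ('f2, 'x2) encoder \<Rightarrow> ('y list \<Rightarrow> nat \<times> nat) \<Rightarrow> bool" where
  "is_code p n M1 M2 Pe enc1 enc2 dec \<longleftrightarrow>
    1 \<le> M1 \<and> 1 \<le> M2 \<and>
    (\<forall>ys. length ys = n \<longrightarrow> dec ys \<in> {1..M1} \<times> {1..M2}) \<and>
    error_probability p n M1 M2 enc1 enc2 dec = Pe"

text \<open>Rates and information quantities are measured with logarithms to a common base \<open>b\<close>.\<close>

definition achievable ::
  "real \<Rightarrow> ('x1, 'x2, 'y, 'f1, 'f2) mac_gf \<Rightarrow> real \<Rightarrow> real \<Rightarrow> bool" where
  "achievable b p R1 R2 \<longleftrightarrow>
    0 \<le> R1 \<and> 0 \<le> R2 \<and>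
    (\<forall>\<epsilon>>0. \<forall>\<^sub>F n in sequentially. \<exists>M1 M2 Pe enc1 enc2 dec.
      is_code p n M1 M2 Pe enc1 enc2 dec \<and>
      R1 \<le> log b (real M1) / real n \<and> R2 \<le> log b (real M2) / real n \<and> Pe \<le> \<epsilon>)"

definition capacity_region ::
  "real \<Rightarrow> ('x1, 'x2, 'y, 'f1, 'f2) mac_gf \<Rightarrow> (real \<times> real) set" where
  "capacity_region b p = closure {(R1, R2). achievable b p R1 R2}"

text \<open>For auxiliary variables with arbitrary alphabets \<open>N1\<close>, \<open>N2\<close> the factorization
  \<open>p(t1,t2,x1,x2,y,u,v) = p(t1,t2,x1,x2) p(y,u,v|x1,x2)\<close> is stated without reference to a
  density for \<open>(T1, T2)\<close>, by integrating it over measurable sets of values \<open>(t1, t2)\<close>.\<close>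

definition mac_gf_variables ::
  "('x1, 'x2, 'y, 'f1, 'f2) mac_gf \<Rightarrow> 'w measure \<Rightarrow> 't1 measure \<Rightarrow> 't2 measure \<Rightarrow>
    ('w \<Rightarrow> 't1) \<Rightarrow> ('w \<Rightarrow> 't2) \<Rightarrow> ('w \<Rightarrow> 'x1) \<Rightarrow> ('w \<Rightarrow> 'x2) \<Rightarrow>
    ('w \<Rightarrow> 'y) \<Rightarrow> ('w \<Rightarrow> 'f1) \<Rightarrow> ('w \<Rightarrow> 'f2) \<Rightarrow> bool" where
  "mac_gf_variables p M N1 N2 T1 T2 X1 X2 Y F1 F2 \<longleftrightarrow>
    prob_space M \<and>
    T1 \<in> M \<rightarrow>\<^sub>M N1 \<and> T2 \<in> M \<rightarrow>\<^sub>M N2 \<and>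
    X1 \<in> M \<rightarrow>\<^sub>M count_space UNIV \<and> X2 \<in> M \<rightarrow>\<^sub>M count_space UNIV \<and>
    Y \<in> M \<rightarrow>\<^sub>M count_space UNIV \<and>
    F1 \<in> M \<rightarrow>\<^sub>M count_space UNIV \<and> F2 \<in> M \<rightarrow>\<^sub>M count_space UNIV \<and>
    (\<forall>A \<in> sets (N1 \<Otimes>\<^sub>M N2). \<forall>x1 x2 y u v.
      measure M {\<omega> \<in> space M. (T1 \<omega>, T2 \<omega>) \<in> A \<and> X1 \<omega> = x1 \<and> X2 \<omega> = x2 \<and>
        Y \<omega> = y \<and> F1 \<omega> = u \<and> F2 \<omega> = v} =
      measure M {\<omega> \<in> space M. (T1 \<omega>, T2 \<omega>) \<in> A \<and> X1 \<omega> = x1 \<and> X2 \<omega> = x2} *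
        pmf (p x1 x2) (y, u, v))"

definition dependence_balance_constraints ::
  "real \<Rightarrow> 'w measure \<Rightarrow> 't1 measure \<Rightarrow> 't2 measure \<Rightarrow>
    ('w \<Rightarrow> 't1) \<Rightarrow> ('w \<Rightarrow> 't2) \<Rightarrow> ('w \<Rightarrow> 'x1) \<Rightarrow> ('w \<Rightarrow> 'x2) \<Rightarrow>
    ('w \<Rightarrow> 'y) \<Rightarrow> ('w \<Rightarrow> 'f1) \<Rightarrow> ('w \<Rightarrow> 'f2) \<Rightarrow> real \<Rightarrow> real \<Rightarrow> bool" where
  "dependence_balance_constraints b M N1 N2 T1 T2 X1 X2 Y F1 F2 R1 R2 \<longleftrightarrow>
    R1 \<le> prob_space.conditional_mutual_information M b
           (count_space UNIV) (count_space UNIV) (count_space UNIV \<Otimes>\<^sub>M N2)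
           X1 (\<lambda>\<omega>. (Y \<omega>, F2 \<omega>)) (\<lambda>\<omega>. (X2 \<omega>, T2 \<omega>)) \<and>
    R2 \<le> prob_space.conditional_mutual_information M b
           (count_space UNIV) (count_space UNIV) (count_space UNIV \<Otimes>\<^sub>M N1)
           X2 (\<lambda>\<omega>. (Y \<omega>, F1 \<omega>)) (\<lambda>\<omega>. (X1 \<omega>, T1 \<omega>)) \<and>
    R1 + R2 \<le> prob_space.conditional_mutual_information M b
           (count_space UNIV) (count_space UNIV) (N1 \<Otimes>\<^sub>M N2)
           (\<lambda>\<omega>. (X1 \<omega>, X2 \<omega>)) (\<lambda>\<omega>. (Y \<omega>, F1 \<omega>, F2 \<omega>)) (\<lambda>\<omega>. (T1 \<omega>, T2 \<omega>)) \<and>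
    R1 + R2 \<le> prob_space.mutual_information M b
           (count_space UNIV) (count_space UNIV) (\<lambda>\<omega>. (X1 \<omega>, X2 \<omega>)) Y \<and>
    prob_space.conditional_mutual_information M b
           (count_space UNIV) (count_space UNIV) (N1 \<Otimes>\<^sub>M N2)
           X1 X2 (\<lambda>\<omega>. (T1 \<omega>, T2 \<omega>))
      \<le> prob_space.conditional_mutual_information M b
           (count_space UNIV) (count_space UNIV)
           (count_space UNIV \<Otimes>\<^sub>M count_space UNIV \<Otimes>\<^sub>M N1 \<Otimes>\<^sub>M N2)
           X1 X2 (\<lambda>\<omega>. (F1 \<omega>, F2 \<omega>, T1 \<omega>, T2 \<omega>))"

text \<open>HOL cannot quantify over types inside a set, so the auxiliary alphabets are taken to be
  the real line with its Borel sets. Every standard Borel space (finite, countable, Euclidean)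
  is isomorphic to a Borel subset of it, and the constraints depend only on the joint
  distribution; for the same reason the sample space may be taken to be the product of the
  seven alphabets.\<close>

definition DB_MAC ::
  "real \<Rightarrow> ('x1, 'x2, 'y, 'f1, 'f2) mac_gf \<Rightarrow> (real \<times> real) set" where
  "DB_MAC b p = {(R1, R2). 0 \<le> R1 \<and> 0 \<le> R2 \<and>
    (\<exists>(M :: (real \<times> real \<times> 'x1 \<times> 'x2 \<times> 'y \<times> 'f1 \<times> 'f2) measure) T1 T2 X1 X2 Y F1 F2.
      mac_gf_variables p M borel borel T1 T2 X1 X2 Y F1 F2 \<and>
      dependence_balance_constraints b M (borel :: real measure) (borel :: real measure)
        T1 T2 X1 X2 Y F1 F2 R1 R2)}"

end

theory Submission
  imports Defs "HOL-Number_Theory.Cong"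
begin

text \<open>
  Given a code of length \<open>n\<close>, put \<open>T = (Y\<^sub>F\<^sub>1, Y\<^sub>F\<^sub>2)\<^sup>i\<^sup>-\<^sup>1\<close> at time \<open>i\<close>. Fano's inequality and the chain rule
  bound the rates by single-letter terms, and the dependence balance inequality is the telescoped
  form of \<open>I(W\<^sub>1; W\<^sub>2) = 0 \<le> I(W\<^sub>1; W\<^sub>2 | Y\<^sub>F\<^sub>1, Y\<^sub>F\<^sub>2)\<close>.

  The capacity region is a closure, so the outer region must be shown to be closed although the
  auxiliary alphabets are unbounded. The key remark is a one-time pad: if \<open>K\<close> has values in
  \<open>{0..<n}\<close> and \<open>U\<close> is independent and uniform, then \<open>T\<^sub>1 = U\<close> and \<open>T\<^sub>2 = K + U mod n\<close> determine \<open>K\<close>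
  jointly while each of them alone is independent of everything else. Conditioning on one of them
  alone is then void, which makes the first two bounds as weak as possible. Hence only the law of
  \<open>\<theta> = P(x\<^sub>1, x\<^sub>2 | T)\<close> matters, and it enters only through the means of \<open>\<theta>\<close> and of two continuous
  functions of \<open>\<theta>\<close>. These means range over the convex hull of a compact set in a Euclidean space,
  which is compact.
\<close>

section \<open>Entropy of finitely supported distributions\<close>

text \<open>Given the inputs, a channel output is independent of everything earlier. Every
  information term is therefore an output entropy minus \<open>noise_entropy\<close>, and the latter
  is linear in the input law. Dropping an auxiliary from the condition of the first two terms only
  enlarges them; after that, only the terms conditioned on both auxiliaries still see the mixture.
  In the converse the mixture label is a uniform time index together with the past feedback of both
  transmitters, and the pad later splits this common label into \<open>T1\<close> and
  \<open>T2\<close>.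

  The balance inequality compares mutual informations between inputs. Written with entropies of the
  feedback alone, it telescopes in time and becomes an average over the mixture like the other
  terms.

  Fano's penalty contains the sum rate of the code itself, which \<open>achievable\<close> bounds
  only from below. The sum rate inequality has to be used once to bound that rate, and only then
  does a small error probability give a small penalty.\<close>

definition pmf_entropy :: "real \<Rightarrow> 'a pmf \<Rightarrow> real" where
  "pmf_entropy b P = measure_pmf.expectation P (\<lambda>x. - log b (pmf P x))"

text \<open>Taking the chain rule as the definition turns most identities below into linear
  arithmetic over joint entropies.\<close>

definition cond_pmf_entropy :: "real \<Rightarrow> 'w pmf \<Rightarrow> ('w \<Rightarrow> 'a) \<Rightarrow> ('w \<Rightarrow> 'c) \<Rightarrow> real" where
  "cond_pmf_entropy b P X Y =
    pmf_entropy b (map_pmf (\<lambda>w. (X w, Y w)) P) - pmf_entropy b (map_pmf Y P)"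

lemma expectation_bind_pmf_finite:
  fixes f :: "'b \<Rightarrow> real"
  assumes "finite (set_pmf P)" "\<And>x. x \<in> set_pmf P \<Longrightarrow> finite (set_pmf (R x))"
  shows "measure_pmf.expectation (bind_pmf P R) f =
    measure_pmf.expectation P (\<lambda>x. measure_pmf.expectation (R x) f)"
  by (simp add: pmf_expectation_bind[OF assms order_refl] integral_measure_pmf[OF assms(1)])

lemma pmf_entropy_map_inj:
  assumes "inj_on f (set_pmf P)"
  shows "pmf_entropy b (map_pmf f P) = pmf_entropy b P"
  unfolding pmf_entropy_def integral_map_pmf
  by (intro integral_cong_AE) (auto simp: AE_measure_pmf_iff pmf_map_inj[OF assms])

text \<open>The entropy of \<open>map_pmf f P\<close> sees only the partition that \<open>f\<close>
  induces on the support. This rule covers every reordering, regrouping and recoding of tuples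
  below.\<close>

lemma pmf_entropy_map_cong:
  assumes "\<And>x y. x \<in> set_pmf P \<Longrightarrow> y \<in> set_pmf P \<Longrightarrow> f x = f y \<longleftrightarrow> g x = g y"
  shows "pmf_entropy b (map_pmf f P) = pmf_entropy b (map_pmf g P)"
proof -
  define h where "h = (\<lambda>u. g (SOME x. x \<in> set_pmf P \<and> f x = u))"
  have h: "h (f x) = g x" if "x \<in> set_pmf P" for x
    unfolding h_def by (rule someI2[of _ x]) (use assms that in auto)
  have "map_pmf g P = map_pmf h (map_pmf f P)"
    unfolding map_pmf_comp by (intro map_pmf_cong refl) (simp add: h)
  moreover have "inj_on h (set_pmf (map_pmf f P))"
    by (rule inj_onI) (use assms in \<open>auto simp: h\<close>)
  ultimately show ?thesis
    by (simp add: pmf_entropy_map_inj)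
qed

lemma cond_pmf_entropy_cong:
  assumes "\<And>w w'. w \<in> set_pmf P \<Longrightarrow> w' \<in> set_pmf P \<Longrightarrow> Y w = Y w' \<longleftrightarrow> Y' w = Y' w'"
    and "\<And>w w'. w \<in> set_pmf P \<Longrightarrow> w' \<in> set_pmf P \<Longrightarrow> Y w = Y w' \<Longrightarrow> X w = X w' \<longleftrightarrow> X' w = X' w'"
  shows "cond_pmf_entropy b P X Y = cond_pmf_entropy b P X' Y'"
  unfolding cond_pmf_entropy_def using assms
  by (intro arg_cong2[where f="(-)"] pmf_entropy_map_cong) auto

lemma cond_pmf_entropy_const:
  assumes "\<And>w. w \<in> set_pmf P \<Longrightarrow> X w = c"
  shows "cond_pmf_entropy b P X Y = 0"
proof -
  have "pmf_entropy b (map_pmf (\<lambda>w. (X w, Y w)) P) = pmf_entropy b (map_pmf Y P)"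
    by (rule pmf_entropy_map_cong) (simp add: assms)
  then show ?thesis by (simp add: cond_pmf_entropy_def)
qed

lemma cond_pmf_entropy_map:
  "cond_pmf_entropy b (map_pmf h P) X Y = cond_pmf_entropy b P (X \<circ> h) (Y \<circ> h)"
  by (simp add: cond_pmf_entropy_def map_pmf_comp comp_def)

text \<open>Nonnegativity of relative entropy, from ln x \<le> x - 1. The mass of \<open>q\<close>
  is constrained on the support only, so \<open>q\<close> may be larger elsewhere.\<close>

lemma gibbs_inequality:
  assumes b: "1 < b" and fin: "finite (set_pmf P)"
    and pos: "\<And>x. x \<in> set_pmf P \<Longrightarrow> 0 < q x"
    and total: "(\<Sum>x\<in>set_pmf P. q x) \<le> 1"
  shows "pmf_entropy b P \<le> measure_pmf.expectation P (\<lambda>x. - log b (q x))"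
proof -
  note [simp] = integrable_measure_pmf_finite[OF fin]
  have "pmf_entropy b P - measure_pmf.expectation P (\<lambda>x. - log b (q x)) =
      measure_pmf.expectation P (\<lambda>x. log b (q x) - log b (pmf P x))"
    by (simp add: pmf_entropy_def)
  also have "\<dots> \<le> measure_pmf.expectation P (\<lambda>x. (q x / pmf P x - 1) / ln b)"
  proof (intro integral_mono_AE)
    show "AE x in P. log b (q x) - log b (pmf P x) \<le> (q x / pmf P x - 1) / ln b"
    proof (clarsimp simp: AE_measure_pmf_iff)
      fix x assume x: "x \<in> set_pmf P"
      have px: "0 < pmf P x" using x by (simp add: pmf_positive)
      have "log b (q x) - log b (pmf P x) = ln (q x / pmf P x) / ln b"
        using pos[OF x] px by (simp add: log_def ln_div diff_divide_distrib)
      also have "\<dots> \<le> (q x / pmf P x - 1) / ln b"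
        using b pos[OF x] px by (intro divide_right_mono ln_le_minus_one) auto
      finally show "log b (q x) - log b (pmf P x) \<le> (q x / pmf P x - 1) / ln b" .
    qed
  qed auto
  also have "\<dots> = ((\<Sum>x\<in>set_pmf P. q x) - 1) / ln b"
  proof -
    have "measure_pmf.expectation P (\<lambda>x. q x / pmf P x) = (\<Sum>x\<in>set_pmf P. q x)"
      by (subst integral_measure_pmf_real[OF fin]) (auto simp: set_pmf_iff intro!: sum.cong)
    then show ?thesis by simp
  qed
  also have "\<dots> \<le> 0"
    using b total by (simp add: divide_nonpos_pos)
  finally show ?thesis by simp
qed

lemma pmf_entropy_uniform:
  assumes "finite A" "A \<noteq> {}"
  shows "pmf_entropy b (pmf_of_set A) = log b (card A)"
  unfolding pmf_entropy_def
  using assms by (simp add: integral_pmf_of_set log_inverse log_def ln_div)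

text \<open>On the support the joint mass is a product of nonzero factors, so its logarithm splits;
  the first summand is constant under the inner average.\<close>

lemma pmf_entropy_bind:
  assumes fin: "finite (set_pmf P)" "\<And>x. x \<in> set_pmf P \<Longrightarrow> finite (set_pmf (R x))"
  shows "pmf_entropy b (bind_pmf P (\<lambda>x. map_pmf (Pair x) (R x))) =
    pmf_entropy b P + measure_pmf.expectation P (\<lambda>x. pmf_entropy b (R x))"
proof -
  let ?B = "bind_pmf P (\<lambda>x. map_pmf (Pair x) (R x))"
  have pmf: "pmf ?B (x, y) = pmf P x * pmf (R x) y" if "x \<in> set_pmf P" for x y
  proof -
    have "pmf ?B (x, y) = (\<Sum>x'\<in>{x}. pmf (map_pmf (Pair x') (R x')) (x, y) * pmf P x')"
      unfolding pmf_bind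
      by (intro integral_measure_pmf_real) (auto simp: set_pmf_iff[symmetric] pmf_eq_0_set_pmf)
    then show ?thesis by (simp add: pmf_map_inj' inj_on_def)
  qed
  have "pmf_entropy b ?B = measure_pmf.expectation P (\<lambda>x. measure_pmf.expectation (R x)
      (\<lambda>y. - log b (pmf ?B (x, y))))"
    unfolding pmf_entropy_def using fin
    by (subst expectation_bind_pmf_finite) auto
  also have "\<dots> = measure_pmf.expectation P (\<lambda>x. measure_pmf.expectation (R x)
      (\<lambda>y. - log b (pmf P x) - log b (pmf (R x) y)))"
  proof (intro integral_cong_AE)
    have "measure_pmf.expectation (R x) (\<lambda>y. - log b (pmf ?B (x, y))) =
        measure_pmf.expectation (R x) (\<lambda>y. - log b (pmf P x) - log b (pmf (R x) y))"
      if x: "x \<in> set_pmf P" for x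
    proof (intro integral_cong_AE)
      show "AE y in R x. - log b (pmf ?B (x, y)) = - log b (pmf P x) - log b (pmf (R x) y)"
        using x by (auto simp: AE_measure_pmf_iff pmf log_mult set_pmf_iff)
    qed auto
    then show "AE x in P. measure_pmf.expectation (R x) (\<lambda>y. - log b (pmf ?B (x, y))) =
        measure_pmf.expectation (R x) (\<lambda>y. - log b (pmf P x) - log b (pmf (R x) y))"
      by (simp add: AE_measure_pmf_iff)
  qed auto
  also have "\<dots> = measure_pmf.expectation P (\<lambda>x. - log b (pmf P x) + pmf_entropy b (R x))"
    by (intro integral_cong_AE)
       (auto simp: AE_measure_pmf_iff pmf_entropy_def integrable_measure_pmf_finite fin)
  also have "\<dots> = pmf_entropy b P + measure_pmf.expectation P (\<lambda>x. pmf_entropy b (R x))"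
    by (simp add: pmf_entropy_def integrable_measure_pmf_finite[OF fin(1)])
  finally show ?thesis .
qed

lemma pmf_entropy_pair:
  assumes "finite (set_pmf P)" "finite (set_pmf Q)"
  shows "pmf_entropy b (pair_pmf P Q) = pmf_entropy b P + pmf_entropy b Q"
  using pmf_entropy_bind[of P "\<lambda>_. Q" b] assms
  by (simp add: pair_pmf_def map_pmf_def)

lemma sum_pmf_map_pair:
  assumes "finite A" "X ` set_pmf P \<subseteq> A"
  shows "(\<Sum>x\<in>A. pmf (map_pmf (\<lambda>w. (X w, Y w)) P) (x, y)) = pmf (map_pmf Y P) y"
proof -
  have "pmf (map_pmf Y P) y = measure_pmf.prob P (\<Union>x\<in>A. (\<lambda>w. (X w, Y w)) -` {(x, y)})"
    unfolding pmf_map using assms(2)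
    by (intro measure_pmf.finite_measure_eq_AE) (auto simp: AE_measure_pmf_iff)
  also have "\<dots> = (\<Sum>x\<in>A. measure_pmf.prob P ((\<lambda>w. (X w, Y w)) -` {(x, y)}))"
    using assms(1) by (intro measure_pmf.finite_measure_finite_Union) (auto simp: disjoint_family_on_def)
  finally show ?thesis by (simp add: pmf_map)
qed

text \<open>Nonnegativity of I(X; Y | Z): Gibbs' inequality against the law that has the same
  marginals on (X, Z) and (Y, Z) but makes X and Y independent given Z.\<close>

lemma cond_pmf_entropy_antimono:
  assumes b: "1 < b" and fin: "finite (set_pmf P)"
  shows "cond_pmf_entropy b P X (\<lambda>w. (Y w, Z w)) \<le> cond_pmf_entropy b P X Z"
proof -
  note [simp] = integrable_measure_pmf_finite[OF fin]
  let ?XYZ = "map_pmf (\<lambda>w. (X w, Y w, Z w)) P" and ?XZ = "map_pmf (\<lambda>w. (X w, Z w)) P"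
    and ?YZ = "map_pmf (\<lambda>w. (Y w, Z w)) P" and ?Z = "map_pmf Z P"
  define q where "q = (\<lambda>(x, y, z). pmf ?XZ (x, z) * pmf ?YZ (y, z) / pmf ?Z z)"
  have pos: "0 < pmf ?XZ (X w, Z w)" "0 < pmf ?YZ (Y w, Z w)" "0 < pmf ?Z (Z w)"
    if "w \<in> set_pmf P" for w
    using that by (auto intro!: pmf_positive)
  have "pmf_entropy b ?XYZ \<le> measure_pmf.expectation ?XYZ (\<lambda>x. - log b (q x))"
  proof (rule gibbs_inequality[OF b])
    let ?A = "X ` set_pmf P" and ?B = "Y ` set_pmf P" and ?C = "Z ` set_pmf P"
    show "0 < q v" if "v \<in> set_pmf ?XYZ" for v
      using that pos by (auto simp: q_def)
    have "(\<Sum>v\<in>set_pmf ?XYZ. q v) \<le> (\<Sum>v\<in>?A \<times> ?B \<times> ?C. q v)"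
      by (intro sum_mono2) (auto simp: fin q_def)
    also have "\<dots> = (\<Sum>x\<in>?A. \<Sum>y\<in>?B. \<Sum>z\<in>?C. q (x, y, z))"
      by (simp add: sum.cartesian_product)
    also have "\<dots> = (\<Sum>x\<in>?A. \<Sum>z\<in>?C. \<Sum>y\<in>?B. q (x, y, z))"
      by (intro sum.cong refl sum.swap)
    also have "\<dots> = (\<Sum>x\<in>?A. \<Sum>z\<in>?C. pmf ?XZ (x, z) / pmf ?Z z * (\<Sum>y\<in>?B. pmf ?YZ (y, z)))"
      by (simp add: q_def sum_distrib_left sum_divide_distrib mult_ac)
    also have "\<dots> = (\<Sum>x\<in>?A. \<Sum>z\<in>?C. pmf ?XZ (x, z))"
      using fin by (intro sum.cong refl) (auto simp: sum_pmf_map_pair set_pmf_iff dest: pos(3))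
    also have "\<dots> = (\<Sum>v\<in>?A \<times> ?C. pmf ?XZ v)"
      by (simp add: sum.cartesian_product)
    also have "\<dots> = 1"
      using fin by (intro sum_pmf_eq_1) auto
    finally show "(\<Sum>v\<in>set_pmf ?XYZ. q v) \<le> 1" .
  qed (simp add: fin)
  also have "\<dots> = measure_pmf.expectation P (\<lambda>w. - log b (pmf ?XZ (X w, Z w))
      - log b (pmf ?YZ (Y w, Z w)) + log b (pmf ?Z (Z w)))"
    unfolding integral_map_pmf
    by (intro integral_cong_AE)
       (use b pos in \<open>auto simp: AE_measure_pmf_iff q_def log_mult log_divide less_imp_neq[symmetric]\<close>)
  also have "\<dots> = pmf_entropy b ?XZ + pmf_entropy b ?YZ - pmf_entropy b ?Z"
    by (simp add: pmf_entropy_def)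
  finally show ?thesis
    by (simp add: cond_pmf_entropy_def)
qed

lemma cond_pmf_entropy_le_function:
  assumes "1 < b" "finite (set_pmf P)"
    and "\<And>w w'. w \<in> set_pmf P \<Longrightarrow> w' \<in> set_pmf P \<Longrightarrow> Y w = Y w' \<Longrightarrow> Z w = Z w'"
  shows "cond_pmf_entropy b P X Y \<le> cond_pmf_entropy b P X Z"
proof -
  have "cond_pmf_entropy b P X Y = cond_pmf_entropy b P X (\<lambda>w. (Y w, Z w))"
    using assms(3) by (intro cond_pmf_entropy_cong) blast+
  then show ?thesis using cond_pmf_entropy_antimono[OF assms(1,2)] by simp
qed

text \<open>Both joint entropies contain the entropy of the label \<open>t\<close>; it cancels in
  the difference and leaves an average over \<open>t\<close>.\<close>

lemma cond_pmf_entropy_mixture: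
  assumes fin: "finite (set_pmf P)" "\<And>t. t \<in> set_pmf P \<Longrightarrow> finite (set_pmf (R t))"
  shows "cond_pmf_entropy b (bind_pmf P (\<lambda>t. map_pmf (Pair t) (R t)))
      (\<lambda>(t, a). X a) (\<lambda>(t, a). (Y a, t)) =
    measure_pmf.expectation P (\<lambda>t. cond_pmf_entropy b (R t) X Y)"
proof -
  note [simp] = integrable_measure_pmf_finite[OF fin(1)]
  let ?B = "bind_pmf P (\<lambda>t. map_pmf (Pair t) (R t))"
  have *: "pmf_entropy b (map_pmf (\<lambda>(t, a). (t, f a)) ?B) =
      pmf_entropy b P + measure_pmf.expectation P (\<lambda>t. pmf_entropy b (map_pmf f (R t)))" for f :: "'b \<Rightarrow> 'k"
    using fin by (subst pmf_entropy_bind[symmetric]) (auto simp: map_bind_pmf map_pmf_comp)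
  have XY: "pmf_entropy b (map_pmf (\<lambda>w. (case w of (t, a) \<Rightarrow> X a, case w of (t, a) \<Rightarrow> (Y a, t))) ?B) =
      pmf_entropy b P + measure_pmf.expectation P (\<lambda>t. pmf_entropy b (map_pmf (\<lambda>a. (X a, Y a)) (R t)))"
    by (subst *[symmetric], rule pmf_entropy_map_cong) auto
  have Y: "pmf_entropy b (map_pmf (\<lambda>(t, a). (Y a, t)) ?B) =
      pmf_entropy b P + measure_pmf.expectation P (\<lambda>t. pmf_entropy b (map_pmf Y (R t)))"
    by (subst *[symmetric], rule pmf_entropy_map_cong) auto
  show ?thesis
    unfolding cond_pmf_entropy_def XY Y by simp
qed

text \<open>The constant \<open>log b 2\<close> stands in for the entropy of the error event and
  vanishes once divided by the block length. A correct decision has weight at least 1/2 in the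
  comparison law and costs at most \<open>log b 2\<close>; a wrong one costs
  \<open>log b (card A)\<close> in addition.\<close>

lemma fano_inequality:
  assumes b: "1 < b" and fin: "finite (set_pmf P)"
    and A: "finite A" "W ` set_pmf P \<subseteq> A"
  shows "cond_pmf_entropy b P W Y \<le>
    log b 2 + measure_pmf.prob P {w. d (Y w) \<noteq> W w} * log b (card A)"
proof -
  note [simp] = integrable_measure_pmf_finite[OF fin]
  let ?WY = "map_pmf (\<lambda>w. (W w, Y w)) P" and ?Y = "map_pmf Y P"
  \<comment> \<open>Gibbs' inequality against the equal mixture of the decision \<open>d y\<close> and the uniform guess.\<close>
  define r where "r = (\<lambda>x y. of_bool (x = d y) / 2 + 1 / (2 * real (card A)))"
  define q where "q = (\<lambda>(x, y). pmf ?Y y * r x y)"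
  obtain w0 where "w0 \<in> set_pmf P" using set_pmf_not_empty[of P] by blast
  then have "A \<noteq> {}" using A by auto
  then have cA: "1 \<le> real (card A)" using A(1) by (simp add: Suc_le_eq card_gt_0_iff)
  have posY: "0 < pmf ?Y (Y w)" if "w \<in> set_pmf P" for w
    using that by (auto intro!: pmf_positive)
  have posr: "0 < r x y" for x y
    using cA by (auto simp: r_def add_pos_nonneg intro!: add_nonneg_pos)
  have "pmf_entropy b ?WY \<le> measure_pmf.expectation ?WY (\<lambda>x. - log b (q x))"
  proof (rule gibbs_inequality[OF b])
    show "0 < q v" if "v \<in> set_pmf ?WY" for v
      using that posY posr by (auto simp: q_def)
    have "(\<Sum>v\<in>set_pmf ?WY. q v) \<le> (\<Sum>v\<in>A \<times> Y ` set_pmf P. q v)"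
      using A by (intro sum_mono2) (auto simp: fin q_def less_imp_le[OF posr])
    also have "\<dots> = (\<Sum>x\<in>A. \<Sum>y\<in>Y ` set_pmf P. q (x, y))"
      by (simp add: sum.cartesian_product)
    also have "\<dots> = (\<Sum>y\<in>Y ` set_pmf P. \<Sum>x\<in>A. q (x, y))"
      by (rule sum.swap)
    also have "\<dots> = (\<Sum>y\<in>Y ` set_pmf P. pmf ?Y y * (\<Sum>x\<in>A. r x y))"
      by (simp add: q_def sum_distrib_left)
    also have "\<dots> \<le> (\<Sum>y\<in>Y ` set_pmf P. pmf ?Y y * 1)"
    proof (intro sum_mono mult_left_mono)
      fix y
      have "(\<Sum>x\<in>A. r x y) = (\<Sum>x\<in>A. of_bool (x = d y)) / 2 + 1 / 2"
        using cA by (simp only: r_def sum.distrib sum_divide_distrib[symmetric] sum_constant) simp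
      also have "(\<Sum>x\<in>A. of_bool (x = d y)) = (of_bool (d y \<in> A) :: real)"
        using A(1) by (simp add: of_bool_def)
      finally show "(\<Sum>x\<in>A. r x y) \<le> 1" by simp
    qed auto
    also have "\<dots> = 1"
      using fin by (simp add: sum_pmf_eq_1)
    finally show "(\<Sum>v\<in>set_pmf ?WY. q v) \<le> 1" .
  qed (simp add: fin)
  also have "\<dots> = measure_pmf.expectation P (\<lambda>w. - log b (pmf ?Y (Y w)) - log b (r (W w) (Y w)))"
    unfolding integral_map_pmf
    by (intro integral_cong_AE)
       (use b posY posr in \<open>auto simp: AE_measure_pmf_iff q_def log_mult less_imp_neq[symmetric]\<close>)
  also have "\<dots> = pmf_entropy b ?Y + measure_pmf.expectation P (\<lambda>w. - log b (r (W w) (Y w)))"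
    by (simp add: pmf_entropy_def)
  also have "measure_pmf.expectation P (\<lambda>w. - log b (r (W w) (Y w))) \<le>
      measure_pmf.expectation P (\<lambda>w. log b 2 + indicator {w. d (Y w) \<noteq> W w} w * log b (card A))"
  proof (intro integral_mono)
    fix w
    show "- log b (r (W w) (Y w)) \<le> log b 2 + indicator {w. d (Y w) \<noteq> W w} w * log b (card A)"
    proof (cases "d (Y w) = W w")
      case True
      have "1 / 2 \<le> r (W w) (Y w)" using True by (simp add: r_def)
      then have "log b (1 / 2) \<le> log b (r (W w) (Y w))"
        using b posr by simp
      then show ?thesis using True by (simp add: log_divide)
    next
      case False
      then have "r (W w) (Y w) = 1 / (2 * real (card A))" by (auto simp: r_def)
      moreover have "log b (1 / (2 * real (card A))) = - (log b 2 + log b (card A))"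
        using cA by (simp add: log_divide log_mult)
      ultimately show ?thesis using False by simp
    qed
  qed auto
  also have "\<dots> = log b 2 + measure_pmf.prob P {w. d (Y w) \<noteq> W w} * log b (card A)"
    by simp
  finally show ?thesis
    by (simp add: cond_pmf_entropy_def)
qed

section \<open>One use of a channel\<close>

text \<open>The past \<open>a\<close> is kept next to the new output, and the output depends on it
  only through the input \<open>X a\<close>: this is where memorylessness enters.\<close>

definition channel_step :: "('x \<Rightarrow> 'z pmf) \<Rightarrow> 'a pmf \<Rightarrow> ('a \<Rightarrow> 'x) \<Rightarrow> ('a \<times> 'z) pmf" where
  "channel_step q P X = bind_pmf P (\<lambda>a. map_pmf (Pair a) (q (X a)))"

text \<open>This is H(K | x), the uncertainty about the observed part of the output that remains
  once the input is known. It is linear in the law of x.\<close>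

definition noise_entropy :: "real \<Rightarrow> ('x \<Rightarrow> 'z pmf) \<Rightarrow> ('z \<Rightarrow> 'k) \<Rightarrow> 'x pmf \<Rightarrow> real" where
  "noise_entropy b q K \<theta> = measure_pmf.expectation \<theta> (\<lambda>x. pmf_entropy b (map_pmf K (q x)))"

lemma finite_set_pmf_channel_step:
  fixes q :: "'x \<Rightarrow> 'z::finite pmf"
  shows "finite (set_pmf P) \<Longrightarrow> finite (set_pmf (channel_step q P X))"
  by (simp add: channel_step_def)

lemma map_fst_channel_step: "map_pmf (\<lambda>w. f (fst w)) (channel_step q P X) = map_pmf f P"
  by (simp add: channel_step_def map_bind_pmf map_pmf_comp map_pmf_const bind_return_pmf' flip: map_pmf_def)

lemma in_set_channel_step: "w \<in> set_pmf (channel_step q P X) \<Longrightarrow> fst w \<in> set_pmf P"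
  by (auto simp: channel_step_def)

lemma map_channel_step:
  "map_pmf (\<lambda>w. (X (fst w), snd w)) (channel_step q P X) = channel_step q (map_pmf X P) id"
  by (simp add: channel_step_def map_bind_pmf bind_map_pmf map_pmf_comp comp_def)

lemma cond_entropy_channel_step_input:
  "cond_pmf_entropy b (channel_step q P X) (\<lambda>w. K (snd w)) (\<lambda>w. L (X (fst w))) =
    cond_pmf_entropy b (channel_step q (map_pmf X P) id) (\<lambda>w. K (snd w)) (\<lambda>w. L (fst w))"
  by (simp add: map_channel_step[symmetric] cond_pmf_entropy_map comp_def)

text \<open>Given the whole past, only the current input matters, so the value is a function of the
  input law alone.\<close>

lemma cond_entropy_channel_step_full:
  fixes q :: "'x \<Rightarrow> 'z::finite pmf"
  assumes "finite (set_pmf P)"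
  shows "cond_pmf_entropy b (channel_step q P X) (\<lambda>w. K (snd w)) fst = noise_entropy b q K (map_pmf X P)"
proof -
  have "pmf_entropy b (map_pmf (\<lambda>w. (K (snd w), fst w)) (channel_step q P X)) =
      pmf_entropy b (map_pmf (\<lambda>w. (fst w, K (snd w))) (channel_step q P X))"
    by (rule pmf_entropy_map_cong) auto
  also have "map_pmf (\<lambda>w. (fst w, K (snd w))) (channel_step q P X) =
      bind_pmf P (\<lambda>a. map_pmf (Pair a) (map_pmf K (q (X a))))"
    by (simp add: channel_step_def map_bind_pmf map_pmf_comp)
  also have "pmf_entropy b \<dots> = pmf_entropy b P + noise_entropy b q K (map_pmf X P)"
    using assms by (subst pmf_entropy_bind) (auto simp: noise_entropy_def)
  finally show ?thesis
    using map_fst_channel_step[of "\<lambda>x. x" q P X] by (simp add: cond_pmf_entropy_def pmf.map_ident)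
qed

lemma noise_entropy_le_cond_entropy:
  fixes q :: "'x \<Rightarrow> 'z::finite pmf"
  assumes "1 < b" "finite (set_pmf P)"
  shows "noise_entropy b q K (map_pmf X P) \<le>
    cond_pmf_entropy b (channel_step q P X) (\<lambda>w. K (snd w)) (\<lambda>w. L (fst w))"
  unfolding cond_entropy_channel_step_full[OF assms(2), symmetric]
  by (rule cond_pmf_entropy_le_function) (auto simp: assms finite_set_pmf_channel_step)

lemma disintegration:
  fixes P :: "'a pmf" and T :: "'a \<Rightarrow> 't" and X :: "'a \<Rightarrow> 'x"
  obtains \<theta> where "map_pmf (\<lambda>a. (T a, X a)) P = bind_pmf (map_pmf T P) (\<lambda>t. map_pmf (Pair t) (\<theta> t))"
proof -
  \<comment> \<open>For \<open>t\<close> outside the support of \<open>T\<close> the conditioning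
    event is null and \<open>\<theta> t\<close> is arbitrary; the outer \<open>bind_pmf\<close>
    never visits such \<open>t\<close>.\<close>
  define \<theta> where "\<theta> = (\<lambda>t. map_pmf X (cond_pmf P ({a. T a = t})))"
  have "map_pmf (\<lambda>a. (T a, X a)) P =
      map_pmf (\<lambda>a. (T a, X a)) (bind_pmf (map_pmf T P) (\<lambda>t. cond_pmf P ({a. T a = t})))"
  proof (subst bind_cond_pmf_cancel)
    fix t a assume "T a = t"
    then have "measure (map_pmf T P) {t. T a = t} = measure (map_pmf T P) {t}"
      by (auto intro!: arg_cong[where f="measure (map_pmf T P)"])
    then show "measure P {a. T a = t} = measure (map_pmf T P) {t. T a = t}"
      by (simp add: measure_pmf_single pmf_map vimage_def)
  qed auto
  also have "\<dots> = bind_pmf (map_pmf T P) (\<lambda>t. map_pmf (Pair t) (\<theta> t))"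
    unfolding map_bind_pmf \<theta>_def map_pmf_comp
  proof (intro bind_pmf_cong refl map_pmf_cong)
    fix t a
    assume "t \<in> set_pmf (map_pmf T P)" and a: "a \<in> set_pmf (cond_pmf P ({a. T a = t}))"
    then have "set_pmf P \<inter> {a. T a = t} \<noteq> {}" by auto
    from set_cond_pmf[OF this] a show "(T a, X a) = (t, X a)" by auto
  qed
  finally show ?thesis using that by blast
qed

text \<open>Given T = t the input has law \<open>\<theta> t\<close>, and the output feels the past
  only through the input. The entropy thus becomes an average of single-letter entropies.\<close>

lemma cond_entropy_channel_step_mixture:
  fixes q :: "'x \<Rightarrow> 'z::finite pmf"
  assumes dis: "map_pmf (\<lambda>a. (T a, X a)) P = bind_pmf \<Lambda> (\<lambda>t. map_pmf (Pair t) (\<theta> t))"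
    and fin: "finite (set_pmf \<Lambda>)" "\<And>t. t \<in> set_pmf \<Lambda> \<Longrightarrow> finite (set_pmf (\<theta> t))"
  shows "cond_pmf_entropy b (channel_step q P X) (\<lambda>w. K (snd w)) (\<lambda>w. (L (X (fst w)), T (fst w))) =
    measure_pmf.expectation \<Lambda> (\<lambda>t. cond_pmf_entropy b (channel_step q (\<theta> t) id)
      (\<lambda>w. K (snd w)) (\<lambda>w. L (fst w)))"
proof -
  have "map_pmf (\<lambda>w. (T (fst w), (X (fst w), snd w))) (channel_step q P X) =
      bind_pmf (map_pmf (\<lambda>a. (T a, X a)) P) (\<lambda>(t, x). map_pmf (\<lambda>z. (t, (x, z))) (q x))"
    by (simp add: channel_step_def map_bind_pmf bind_map_pmf map_pmf_comp)
  also have "\<dots> = bind_pmf \<Lambda> (\<lambda>t. map_pmf (Pair t) (channel_step q (\<theta> t) id))"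
    unfolding dis by (simp add: channel_step_def bind_assoc_pmf map_bind_pmf bind_map_pmf map_pmf_comp)
  finally have *: "map_pmf (\<lambda>w. (T (fst w), (X (fst w), snd w))) (channel_step q P X) = \<dots>" .
  have "cond_pmf_entropy b (channel_step q P X) (\<lambda>w. K (snd w)) (\<lambda>w. (L (X (fst w)), T (fst w))) =
     cond_pmf_entropy b (map_pmf (\<lambda>w. (T (fst w), (X (fst w), snd w))) (channel_step q P X))
       (\<lambda>(t, w). K (snd w)) (\<lambda>(t, w). (L (fst w), t))"
    by (simp add: cond_pmf_entropy_map comp_def)
  also have "\<dots> = measure_pmf.expectation \<Lambda> (\<lambda>t. cond_pmf_entropy b (channel_step q (\<theta> t) id)
      (\<lambda>w. K (snd w)) (\<lambda>w. L (fst w)))"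
    unfolding * by (rule cond_pmf_entropy_mixture) (use fin in \<open>auto intro: finite_set_pmf_channel_step\<close>)
  finally show ?thesis .
qed

lemma noise_entropy_mixture:
  assumes "finite (set_pmf \<Lambda>)" "\<And>t. t \<in> set_pmf \<Lambda> \<Longrightarrow> finite (set_pmf (\<theta> t))"
  shows "noise_entropy b q K (bind_pmf \<Lambda> \<theta>) =
    measure_pmf.expectation \<Lambda> (\<lambda>t. noise_entropy b q K (\<theta> t))"
  unfolding noise_entropy_def by (rule expectation_bind_pmf_finite[OF assms])

text \<open>The left side is the entropy with the label \<open>t\<close> as an additional condition;
  forgetting the label can only increase it.\<close>

lemma cond_entropy_concave:
  fixes q :: "'x \<Rightarrow> 'z::finite pmf"
  assumes b: "1 < b"
    and fin: "finite (set_pmf \<Lambda>)" "\<And>t. t \<in> set_pmf \<Lambda> \<Longrightarrow> finite (set_pmf (\<theta> t))"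
  shows "measure_pmf.expectation \<Lambda> (\<lambda>t. cond_pmf_entropy b (channel_step q (\<theta> t) id)
      (\<lambda>w. K (snd w)) (\<lambda>w. L (fst w))) \<le>
    cond_pmf_entropy b (channel_step q (bind_pmf \<Lambda> \<theta>) id) (\<lambda>w. K (snd w)) (\<lambda>w. L (fst w))"
proof -
  let ?P = "bind_pmf \<Lambda> (\<lambda>t. map_pmf (Pair t) (\<theta> t))"
  have snd: "map_pmf snd ?P = bind_pmf \<Lambda> \<theta>"
    by (simp add: map_bind_pmf map_pmf_comp)
  have "measure_pmf.expectation \<Lambda> (\<lambda>t. cond_pmf_entropy b (channel_step q (\<theta> t) id)
      (\<lambda>w. K (snd w)) (\<lambda>w. L (fst w))) =
    cond_pmf_entropy b (channel_step q ?P snd) (\<lambda>w. K (snd w)) (\<lambda>w. (L (snd (fst w)), fst (fst w)))"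
    by (rule cond_entropy_channel_step_mixture[symmetric]) (auto simp: fin pmf.map_ident)
  also have "\<dots> \<le> cond_pmf_entropy b (channel_step q ?P snd) (\<lambda>w. K (snd w)) (\<lambda>w. L (snd (fst w)))"
    using fin by (intro cond_pmf_entropy_le_function b finite_set_pmf_channel_step) auto
  also have "\<dots> = cond_pmf_entropy b (channel_step q (bind_pmf \<Lambda> \<theta>) id) (\<lambda>w. K (snd w)) (\<lambda>w. L (fst w))"
    by (simp add: cond_entropy_channel_step_input snd)
  finally show ?thesis .
qed

text \<open>Symmetry of I(X; K | L). It trades uncertainty about a message or an input for
  uncertainty about outputs.\<close>

lemma cond_entropy_swap:
  "cond_pmf_entropy b P X (\<lambda>w. (K w, L w)) =
    cond_pmf_entropy b P X L - cond_pmf_entropy b P K L + cond_pmf_entropy b P K (\<lambda>w. (X w, L w))"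
proof -
  have "pmf_entropy b (map_pmf (\<lambda>w. (X w, K w, L w)) P) = pmf_entropy b (map_pmf (\<lambda>w. (K w, X w, L w)) P)"
    by (rule pmf_entropy_map_cong) auto
  then show ?thesis by (simp add: cond_pmf_entropy_def)
qed

lemma cond_entropy_chain:
  "cond_pmf_entropy b P (\<lambda>w. (X w, K w)) L =
    cond_pmf_entropy b P X L + cond_pmf_entropy b P K (\<lambda>w. (L w, X w))"
proof -
  have "pmf_entropy b (map_pmf (\<lambda>w. ((X w, K w), L w)) P) = pmf_entropy b (map_pmf (\<lambda>w. (K w, L w, X w)) P)"
    by (rule pmf_entropy_map_cong) auto
  moreover have "pmf_entropy b (map_pmf (\<lambda>w. (X w, L w)) P) = pmf_entropy b (map_pmf (\<lambda>w. (L w, X w)) P)"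
    by (rule pmf_entropy_map_cong) auto
  ultimately show ?thesis by (simp add: cond_pmf_entropy_def)
qed

section \<open>Channels used with feedback\<close>

text \<open>The state after m uses is the message with the list of outputs so far, and the input is
  an arbitrary function of both. Which feedback an encoder really sees enters only through
  hypotheses of the lemmas below.\<close>

locale channel_process =
  fixes q :: "'x::finite \<Rightarrow> 'z::finite pmf"
    and X :: "nat \<Rightarrow> 'w \<times> 'z list \<Rightarrow> 'x"
    and \<Omega> :: "nat \<Rightarrow> ('w \<times> 'z list) pmf"
    and b :: real
  assumes b: "1 < b"
    and finite_start: "finite (set_pmf (\<Omega> 0))"
    and start: "w \<in> set_pmf (\<Omega> 0) \<Longrightarrow> snd w = []"
    and step: "\<Omega> (Suc m) = map_pmf (\<lambda>w. (fst (fst w), snd (fst w) @ [snd w])) (channel_step q (\<Omega> m) (X m))"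
begin

lemma finite_process: "finite (set_pmf (\<Omega> m))"
  by (induction m) (auto simp: finite_start step finite_set_pmf_channel_step)

lemma map_message_process: "map_pmf (\<lambda>w. h (fst w)) (\<Omega> m) = map_pmf (\<lambda>w. h (fst w)) (\<Omega> 0)"
  by (induction m) (auto simp: step map_pmf_comp map_fst_channel_step[where f="\<lambda>w. h (fst w)"])

lemma cond_entropy_message:
  "cond_pmf_entropy b (\<Omega> m) (\<lambda>w. k (fst w)) (\<lambda>w. h (fst w)) =
    cond_pmf_entropy b (\<Omega> 0) (\<lambda>w. k (fst w)) (\<lambda>w. h (fst w))"
  unfolding cond_pmf_entropy_def
  using map_message_process[of "\<lambda>w. (k w, h w)" m] map_message_process[of h m] by simp

lemma cond_entropy_past:
  "cond_pmf_entropy b (channel_step q (\<Omega> m) (X m)) (\<lambda>w. f (fst w)) (\<lambda>w. g (fst w)) =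
    cond_pmf_entropy b (\<Omega> m) f g"
  by (simp add: cond_pmf_entropy_def map_fst_channel_step[of "\<lambda>w. (f w, g w)"] map_fst_channel_step[of g])

text \<open>The left side is I(W; K^m | h(W)), where \<open>h\<close> models side information about
  the message. By the chain rule each new output contributes its entropy given \<open>h\<close> and
  its own past, at most that given \<open>G\<close>, minus its entropy given the full message as
  well, at least the noise.\<close>

lemma information_bound:
  assumes G: "\<And>i v w. \<lbrakk>v \<in> set_pmf (\<Omega> i); w \<in> set_pmf (\<Omega> i); h (fst v) = h (fst w);
      map K (snd v) = map K (snd w)\<rbrakk> \<Longrightarrow> G i v = G i w"
  shows "cond_pmf_entropy b (\<Omega> m) fst (\<lambda>w. h (fst w)) -
      cond_pmf_entropy b (\<Omega> m) fst (\<lambda>w. (h (fst w), map K (snd w))) \<le>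
    (\<Sum>i<m. cond_pmf_entropy b (channel_step q (\<Omega> i) (X i)) (\<lambda>w. K (snd w)) (\<lambda>w. G i (fst w)) -
      noise_entropy b q K (map_pmf (X i) (\<Omega> i)))"
proof (induction m)
  case 0
  have "cond_pmf_entropy b (\<Omega> 0) fst (\<lambda>w. h (fst w)) =
      cond_pmf_entropy b (\<Omega> 0) fst (\<lambda>w. (h (fst w), map K (snd w)))"
    by (rule cond_pmf_entropy_cong) (auto dest!: start)
  then show ?case by simp
next
  case (Suc m)
  let ?S = "channel_step q (\<Omega> m) (X m)"
  let ?W = "\<lambda>w. fst (fst w)" and ?L = "\<lambda>w. (h (fst (fst w)), map K (snd (fst w)))" and ?K = "\<lambda>w. K (snd w)"
  have fin: "finite (set_pmf ?S)" by (simp add: finite_set_pmf_channel_step finite_process)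
  have "cond_pmf_entropy b (\<Omega> (Suc m)) fst (\<lambda>w. (h (fst w), map K (snd w))) =
      cond_pmf_entropy b ?S ?W (\<lambda>w. (?K w, ?L w))"
    unfolding step cond_pmf_entropy_map comp_def by (rule cond_pmf_entropy_cong) auto
  also have "\<dots> = cond_pmf_entropy b ?S ?W ?L - cond_pmf_entropy b ?S ?K ?L +
      cond_pmf_entropy b ?S ?K (\<lambda>w. (?W w, ?L w))"
    by (rule cond_entropy_swap)
  also have "cond_pmf_entropy b ?S ?W ?L = cond_pmf_entropy b (\<Omega> m) fst (\<lambda>w. (h (fst w), map K (snd w)))"
    by (rule cond_entropy_past)
  finally have "cond_pmf_entropy b (\<Omega> (Suc m)) fst (\<lambda>w. (h (fst w), map K (snd w))) =
      cond_pmf_entropy b (\<Omega> m) fst (\<lambda>w. (h (fst w), map K (snd w))) -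
      cond_pmf_entropy b ?S ?K ?L + cond_pmf_entropy b ?S ?K (\<lambda>w. (?W w, ?L w))" .
  moreover have "noise_entropy b q K (map_pmf (X m) (\<Omega> m)) \<le> cond_pmf_entropy b ?S ?K (\<lambda>w. (?W w, ?L w))"
    by (rule noise_entropy_le_cond_entropy[OF b finite_process,
        where L="\<lambda>w. (fst w, h (fst w), map K (snd w))"])
  moreover have "cond_pmf_entropy b ?S ?K ?L \<le> cond_pmf_entropy b ?S ?K (\<lambda>w. G m (fst w))"
    by (rule cond_pmf_entropy_le_function[OF b fin]) (auto intro!: G dest!: in_set_channel_step)
  moreover have "cond_pmf_entropy b (\<Omega> (Suc m)) fst (\<lambda>w. h (fst w)) = cond_pmf_entropy b (\<Omega> m) fst (\<lambda>w. h (fst w))"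
    using cond_entropy_message[of "Suc m" "\<lambda>w. w" h] cond_entropy_message[of m "\<lambda>w. w" h] by simp
  ultimately show ?case using Suc.IH by simp
qed

lemma cond_entropy_history_step:
  "cond_pmf_entropy b (\<Omega> (Suc m)) (\<lambda>w. map F (snd w)) (\<lambda>w. h (fst w)) =
    cond_pmf_entropy b (\<Omega> m) (\<lambda>w. map F (snd w)) (\<lambda>w. h (fst w)) +
    cond_pmf_entropy b (channel_step q (\<Omega> m) (X m)) (\<lambda>w. F (snd w))
      (\<lambda>w. (h (fst (fst w)), map F (snd (fst w))))"
proof -
  let ?S = "channel_step q (\<Omega> m) (X m)"
  have "cond_pmf_entropy b (\<Omega> (Suc m)) (\<lambda>w. map F (snd w)) (\<lambda>w. h (fst w)) =
      cond_pmf_entropy b ?S (\<lambda>w. (map F (snd (fst w)), F (snd w))) (\<lambda>w. h (fst (fst w)))"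
    unfolding step cond_pmf_entropy_map comp_def by (rule cond_pmf_entropy_cong) auto
  also have "\<dots> = cond_pmf_entropy b ?S (\<lambda>w. map F (snd (fst w))) (\<lambda>w. h (fst (fst w))) +
      cond_pmf_entropy b ?S (\<lambda>w. F (snd w)) (\<lambda>w. (h (fst (fst w)), map F (snd (fst w))))"
    by (rule cond_entropy_chain)
  finally show ?thesis
    using cond_entropy_past[where f="\<lambda>w. map F (snd w)" and g="\<lambda>w. h (fst w)"] by simp
qed

text \<open>Read x1, x2 for the values of \<open>g1\<close>, \<open>g2\<close>. When they determine
  the input, summand i is I(x1; x2 | F, T) - I(x1; x2 | T), with T the past of
  \<open>F\<close>.\<close>

lemma dependence_balance:
  fixes h1 :: "'w \<Rightarrow> 'h1" and h2 :: "'w \<Rightarrow> 'h2"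
  assumes indep: "pmf_entropy b (map_pmf (\<lambda>w. h1 (fst w)) (\<Omega> 0)) + pmf_entropy b (map_pmf (\<lambda>w. h2 (fst w)) (\<Omega> 0)) =
      pmf_entropy b (map_pmf fst (\<Omega> 0))"
    and inj: "inj (\<lambda>w. (h1 w, h2 w))"
    and X1: "\<And>i v w. \<lbrakk>v \<in> set_pmf (\<Omega> i); w \<in> set_pmf (\<Omega> i); h1 (fst v) = h1 (fst w);
      map F (snd v) = map F (snd w)\<rbrakk> \<Longrightarrow> g1 (X i v) = g1 (X i w)"
    and X2: "\<And>i v w. \<lbrakk>v \<in> set_pmf (\<Omega> i); w \<in> set_pmf (\<Omega> i); h2 (fst v) = h2 (fst w);
      map F (snd v) = map F (snd w)\<rbrakk> \<Longrightarrow> g2 (X i v) = g2 (X i w)"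
  shows "0 \<le> (\<Sum>i<m.
    cond_pmf_entropy b (channel_step q (\<Omega> i) (X i)) (\<lambda>w. F (snd w)) (\<lambda>w. (g1 (X i (fst w)), map F (snd (fst w)))) +
    cond_pmf_entropy b (channel_step q (\<Omega> i) (X i)) (\<lambda>w. F (snd w)) (\<lambda>w. (g2 (X i (fst w)), map F (snd (fst w)))) -
    cond_pmf_entropy b (channel_step q (\<Omega> i) (X i)) (\<lambda>w. F (snd w)) (\<lambda>w. map F (snd (fst w))) -
    noise_entropy b q F (map_pmf (X i) (\<Omega> i)))" (is "_ \<le> (\<Sum>i<m. ?d i)")
proof -
  \<comment> \<open>\<open>?D m\<close> is I(W1; W2 | F^m) - I(W1; W2), expanded into entropies of
    the history. Its increments are at most the summands, and independence of the messages makes it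
    nonnegative.\<close>
  let ?D = "\<lambda>m. cond_pmf_entropy b (\<Omega> m) (\<lambda>w. map F (snd w)) (\<lambda>w. h1 (fst w)) +
    cond_pmf_entropy b (\<Omega> m) (\<lambda>w. map F (snd w)) (\<lambda>w. h2 (fst w)) -
    cond_pmf_entropy b (\<Omega> m) (\<lambda>w. map F (snd w)) (\<lambda>w. ()) -
    cond_pmf_entropy b (\<Omega> m) (\<lambda>w. map F (snd w)) fst"
  have upper: "?D m \<le> (\<Sum>i<m. ?d i)"
  proof (induction m)
    case 0
    have "map F (snd w) = []" if "w \<in> set_pmf (\<Omega> 0)" for w
      using start[OF that] by simp
    note cond_pmf_entropy_const[OF this, simp]
    show ?case by simp
  next
    case (Suc m)
    let ?S = "channel_step q (\<Omega> m) (X m)"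
    let ?F = "\<lambda>w. F (snd w)" and ?T = "\<lambda>w. map F (snd (fst w))"
    have fin: "finite (set_pmf ?S)" by (simp add: finite_set_pmf_channel_step finite_process)
    \<comment> \<open>The added terms may grow, so a message part is replaced by the input it
      determines, a coarser condition. The joint term is subtracted and is bounded below by the
      noise.\<close>
    have "cond_pmf_entropy b ?S ?F (\<lambda>w. (h1 (fst (fst w)), ?T w)) \<le>
        cond_pmf_entropy b ?S ?F (\<lambda>w. (g1 (X m (fst w)), ?T w))"
      by (rule cond_pmf_entropy_le_function[OF b fin]) (use X1 in \<open>blast dest!: in_set_channel_step\<close>)
    moreover have "cond_pmf_entropy b ?S ?F (\<lambda>w. (h2 (fst (fst w)), ?T w)) \<le>
        cond_pmf_entropy b ?S ?F (\<lambda>w. (g2 (X m (fst w)), ?T w))"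
      by (rule cond_pmf_entropy_le_function[OF b fin]) (use X2 in \<open>blast dest!: in_set_channel_step\<close>)
    moreover have "noise_entropy b q F (map_pmf (X m) (\<Omega> m)) \<le>
        cond_pmf_entropy b ?S ?F (\<lambda>w. (fst (fst w), ?T w))"
      by (rule noise_entropy_le_cond_entropy[OF b finite_process, where L="\<lambda>w. (fst w, map F (snd w))"])
    moreover have "cond_pmf_entropy b ?S ?F (\<lambda>w. ((), ?T w)) = cond_pmf_entropy b ?S ?F ?T"
      by (rule cond_pmf_entropy_cong) auto
    ultimately show ?case
      using Suc.IH cond_entropy_history_step[of m F "\<lambda>w. ()"] cond_entropy_history_step[of m F "\<lambda>w. w"]
        cond_entropy_history_step[of m F h1] cond_entropy_history_step[of m F h2] by simp
  qed
  let ?T = "\<lambda>w. map F (snd w)"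
  \<comment> \<open>This is nonnegativity of I(W1; W2 | F^m).\<close>
  have sub: "cond_pmf_entropy b (\<Omega> m) (\<lambda>w. h1 (fst w)) (\<lambda>w. (h2 (fst w), ?T w)) \<le>
      cond_pmf_entropy b (\<Omega> m) (\<lambda>w. h1 (fst w)) ?T"
    by (rule cond_pmf_entropy_antimono[OF b finite_process])
  have 1: "pmf_entropy b (map_pmf (\<lambda>w. (?T w, h1 (fst w))) (\<Omega> m)) =
      pmf_entropy b (map_pmf (\<lambda>w. (h1 (fst w), ?T w)) (\<Omega> m))"
    by (rule pmf_entropy_map_cong) auto
  have 2: "pmf_entropy b (map_pmf (\<lambda>w. (?T w, h2 (fst w))) (\<Omega> m)) =
      pmf_entropy b (map_pmf (\<lambda>w. (h2 (fst w), ?T w)) (\<Omega> m))"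
    by (rule pmf_entropy_map_cong) auto
  have 3: "pmf_entropy b (map_pmf (\<lambda>w. (?T w, ())) (\<Omega> m)) = pmf_entropy b (map_pmf ?T (\<Omega> m))"
    by (rule pmf_entropy_map_cong) auto
  have 4: "pmf_entropy b (map_pmf (\<lambda>w. (?T w, fst w)) (\<Omega> m)) =
      pmf_entropy b (map_pmf (\<lambda>w. (h1 (fst w), h2 (fst w), ?T w)) (\<Omega> m))"
    by (rule pmf_entropy_map_cong) (use inj in \<open>auto simp: inj_def\<close>)
  have 5: "pmf_entropy b (map_pmf (\<lambda>w. ()) (\<Omega> m)) = 0"
    by (simp add: map_pmf_const pmf_entropy_def)
  have 6: "pmf_entropy b (map_pmf (\<lambda>w. h1 (fst w)) (\<Omega> m)) + pmf_entropy b (map_pmf (\<lambda>w. h2 (fst w)) (\<Omega> m)) =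
      pmf_entropy b (map_pmf fst (\<Omega> m))"
    using indep map_message_process[of h1 m] map_message_process[of h2 m] map_message_process[of "\<lambda>x. x" m] by simp
  have "0 \<le> ?D m"
    using sub 6 unfolding cond_pmf_entropy_def 1 2 3 4 5 by simp
  with upper show ?thesis by simp
qed

end

section \<open>Mixtures of input distributions and closedness\<close>

text \<open>Continuity on the whole line matches \<open>continuous_functional\<close>, which asks
  for an extension to all vectors. Here ln y = ln |y|, so negative arguments behave like positive
  ones.\<close>

lemma isCont_x_ln_x: "isCont (\<lambda>x::real. x * ln x) x"
proof (cases "x = 0")
  case False
  then show ?thesis by (intro continuous_intros) auto
next
  case True
  have bound: "\<bar>y * ln y\<bar> \<le> 2 * sqrt \<bar>y\<bar>" if "\<bar>y\<bar> \<le> 1" for y :: real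
  proof (cases "y = 0")
    case False
    have ln_abs: "ln y = ln \<bar>y\<bar>" by (simp add: ln_real_def)
    \<comment> \<open>The bound ln x \<le> x - 1 at x = 1 / sqrt |y| yields |y ln y| \<le> 2 sqrt
      |y|, which tends to 0.\<close>
    have "ln (1 / sqrt \<bar>y\<bar>) \<le> 1 / sqrt \<bar>y\<bar> - 1"
      using False by (intro ln_le_minus_one) simp
    then have "- ln \<bar>y\<bar> \<le> 2 * (1 / sqrt \<bar>y\<bar>)"
      using False by (simp add: ln_div ln_sqrt)
    moreover have "ln \<bar>y\<bar> \<le> 0" using that False by simp
    ultimately have "\<bar>y\<bar> * \<bar>ln \<bar>y\<bar>\<bar> \<le> \<bar>y\<bar> * (2 * (1 / sqrt \<bar>y\<bar>))"
      by (intro mult_left_mono) auto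
    also have "\<dots> = 2 * (\<bar>y\<bar> / sqrt \<bar>y\<bar>)" by simp
    also have "\<dots> = 2 * sqrt \<bar>y\<bar>" by (subst real_div_sqrt) auto
    finally show ?thesis by (simp add: ln_abs abs_mult)
  qed simp
  have "((\<lambda>y::real. y * ln y) \<longlongrightarrow> 0) (at 0)"
  proof (rule Lim_null_comparison)
    show "\<forall>\<^sub>F y in at (0::real). norm (y * ln y) \<le> 2 * sqrt \<bar>y\<bar>"
      using bound by (auto simp: eventually_at intro!: exI[of _ 1])
    have "isCont (\<lambda>y::real. 2 * sqrt \<bar>y\<bar>) 0" by (intro continuous_intros)
    then show "((\<lambda>y::real. 2 * sqrt \<bar>y\<bar>) \<longlongrightarrow> 0) (at 0)"
      by (simp add: isCont_def)
  qed
  then show ?thesis by (simp add: True isCont_def)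
qed

section \<open>The probability simplex, continuous functions on it, and hulls of mixtures\<close>

definition pmf_vec :: "'x::finite pmf \<Rightarrow> real ^ 'x" where
  "pmf_vec \<theta> = (\<chi> x. pmf \<theta> x)"

lemma pmf_vec_nth [simp]: "pmf_vec \<theta> $ x = pmf \<theta> x"
  by (simp add: pmf_vec_def)

lemma pmf_vec_inject: "pmf_vec \<theta> = pmf_vec \<theta>' \<longleftrightarrow> \<theta> = \<theta>'"
  by (auto simp: vec_eq_iff pmf_eq_iff)

lemma range_pmf_vec: "range pmf_vec = {v :: real ^ 'x::finite. (\<forall>x. 0 \<le> v $ x) \<and> (\<Sum>x\<in>UNIV. v $ x) = 1}"
proof (intro equalityI subsetI)
  fix v :: "real ^ 'x" assume "v \<in> range pmf_vec"
  then show "v \<in> {v. (\<forall>x. 0 \<le> v $ x) \<and> (\<Sum>x\<in>UNIV. v $ x) = 1}"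
    by (auto intro!: sum_pmf_eq_1)
next
  fix v :: "real ^ 'x" assume v: "v \<in> {v. (\<forall>x. 0 \<le> v $ x) \<and> (\<Sum>x\<in>UNIV. v $ x) = 1}"
  have "pmf (embed_pmf (\<lambda>x. v $ x)) x = v $ x" for x
    by (rule pmf_embed_pmf) (use v in \<open>auto simp: nn_integral_count_space_finite sum_ennreal\<close>)
  then have "v = pmf_vec (embed_pmf (\<lambda>x. v $ x))"
    by (simp add: vec_eq_iff)
  then show "v \<in> range pmf_vec" by blast
qed

lemma compact_range_pmf_vec: "compact (range (pmf_vec :: 'x::finite pmf \<Rightarrow> real ^ 'x))"
  unfolding compact_eq_bounded_closed
proof
  have "norm (v :: real ^ 'x) \<le> real CARD('x)" if "v \<in> range pmf_vec" for v
  proof -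
    have "norm v \<le> (\<Sum>x\<in>UNIV. \<bar>v $ x\<bar>)" by (rule norm_le_l1_cart)
    also have "\<dots> \<le> (\<Sum>x\<in>(UNIV :: 'x set). 1)"
      using that by (intro sum_mono) (auto simp: pmf_le_1)
    finally show ?thesis by simp
  qed
  then show "bounded (range (pmf_vec :: 'x pmf \<Rightarrow> real ^ 'x))"
    by (auto simp: bounded_iff)
  have "{v :: real ^ 'x. (\<forall>x. 0 \<le> v $ x) \<and> (\<Sum>x\<in>UNIV. v $ x) = 1} =
      (\<Inter>x. {v. 0 \<le> v $ x}) \<inter> {v. (\<Sum>x\<in>UNIV. v $ x) = 1}"
    by auto
  also have "closed \<dots>"
    by (intro closed_Int closed_INT ballI closed_Collect_le closed_Collect_eq continuous_intros)
  finally show "closed (range (pmf_vec :: 'x pmf \<Rightarrow> real ^ 'x))"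
    by (simp add: range_pmf_vec)
qed

lemma pmf_vec_bind:
  assumes "finite (set_pmf \<Lambda>)"
  shows "pmf_vec (bind_pmf \<Lambda> \<theta>) = (\<Sum>t\<in>set_pmf \<Lambda>. pmf \<Lambda> t *\<^sub>R pmf_vec (\<theta> t))"
  by (simp add: vec_eq_iff pmf_bind integral_measure_pmf[OF assms])

text \<open>A continuous extension to the whole space keeps subspace topologies out of the
  compactness and closedness arguments.\<close>

definition continuous_functional :: "('x::finite pmf \<Rightarrow> real) \<Rightarrow> bool" where
  "continuous_functional f \<longleftrightarrow> (\<exists>F. continuous_on UNIV F \<and> (\<forall>\<theta>. f \<theta> = F (pmf_vec \<theta>)))"

lemma continuous_functional_add:
  assumes "continuous_functional f" "continuous_functional g"
  shows "continuous_functional (\<lambda>\<theta>. f \<theta> + g \<theta>)"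
proof -
  from assms obtain F G where "continuous_on UNIV F" "\<And>\<theta>. f \<theta> = F (pmf_vec \<theta>)"
    "continuous_on UNIV G" "\<And>\<theta>. g \<theta> = G (pmf_vec \<theta>)"
    unfolding continuous_functional_def by blast
  then show ?thesis unfolding continuous_functional_def
    by (intro exI[of _ "\<lambda>v. F v + G v"]) (auto intro: continuous_on_add)
qed

lemma continuous_functional_diff:
  assumes "continuous_functional f" "continuous_functional g"
  shows "continuous_functional (\<lambda>\<theta>. f \<theta> - g \<theta>)"
proof -
  from assms obtain F G where "continuous_on UNIV F" "\<And>\<theta>. f \<theta> = F (pmf_vec \<theta>)"
    "continuous_on UNIV G" "\<And>\<theta>. g \<theta> = G (pmf_vec \<theta>)"
    unfolding continuous_functional_def by blast
  then show ?thesis unfolding continuous_functional_def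
    by (intro exI[of _ "\<lambda>v. F v - G v"]) (auto intro: continuous_on_diff)
qed

lemma continuous_functional_noise_entropy:
  "continuous_functional (noise_entropy b (q :: 'x::finite \<Rightarrow> 'z pmf) K)"
  unfolding continuous_functional_def
proof (intro exI conjI allI)
  show "continuous_on UNIV (\<lambda>v :: real ^ 'x. \<Sum>x\<in>UNIV. v $ x * pmf_entropy b (map_pmf K (q x)))"
    by (intro continuous_intros)
  show "noise_entropy b q K \<theta> = (\<Sum>x\<in>UNIV. pmf_vec \<theta> $ x * pmf_entropy b (map_pmf K (q x)))" for \<theta>
    by (simp add: noise_entropy_def integral_measure_pmf[of UNIV])
qed

text \<open>Every output probability is linear in the input law, so the entropy is a finite sum of t
  ln t over linear forms.\<close>

lemma continuous_functional_entropy: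
  fixes q :: "'x::finite \<Rightarrow> 'z pmf" and K :: "'x \<times> 'z \<Rightarrow> 'k::finite"
  shows "continuous_functional (\<lambda>\<theta>. pmf_entropy b (map_pmf K (channel_step q \<theta> id)))"
  unfolding continuous_functional_def
proof (intro exI conjI allI)
  define R where "R = (\<lambda>k x. pmf (map_pmf (\<lambda>z. K (x, z)) (q x)) k)"
  define \<eta> where "\<eta> = (\<lambda>t :: real. t * ln t)"
  have "continuous_on UNIV \<eta>"
    unfolding \<eta>_def by (intro continuous_at_imp_continuous_on ballI isCont_x_ln_x)
  then have cont: "continuous_on UNIV (\<lambda>v :: real ^ 'x. \<eta> (f v))" if "continuous_on UNIV f" for f
    using that by (auto intro: continuous_on_compose2)
  show "continuous_on UNIV (\<lambda>v :: real ^ 'x. - (\<Sum>k\<in>UNIV. \<eta> (\<Sum>x\<in>UNIV. v $ x * R k x)) / ln b)"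
    unfolding divide_inverse by (intro continuous_intros cont)
  fix \<theta> :: "'x pmf"
  let ?P = "map_pmf K (channel_step q \<theta> id)"
  have pmf: "pmf ?P k = (\<Sum>x\<in>UNIV. pmf_vec \<theta> $ x * R k x)" for k
    by (simp add: channel_step_def map_bind_pmf map_pmf_comp pmf_bind R_def integral_measure_pmf[of UNIV])
  have "pmf_entropy b P = (\<Sum>k\<in>UNIV. - (\<eta> (pmf P k) / ln b))" for P :: "'k pmf"
    by (simp add: pmf_entropy_def integral_measure_pmf[of UNIV] \<eta>_def log_def sum_negf sum_divide_distrib)
  then show "pmf_entropy b ?P = - (\<Sum>k\<in>UNIV. \<eta> (\<Sum>x\<in>UNIV. pmf_vec \<theta> $ x * R k x)) / ln b"
    by (simp add: pmf sum_negf sum_divide_distrib)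
qed

lemma continuous_functional_cond_entropy:
  fixes q :: "'x::finite \<Rightarrow> 'z::finite pmf" and K :: "'x \<times> 'z \<Rightarrow> 'k::finite" and L :: "'x \<times> 'z \<Rightarrow> 'l::finite"
  shows "continuous_functional (\<lambda>\<theta>. cond_pmf_entropy b (channel_step q \<theta> id) K L)"
  unfolding cond_pmf_entropy_def
  by (intro continuous_functional_diff continuous_functional_entropy)

text \<open>A point lists the averaged input law and the averages of \<open>f\<close> and
  \<open>g\<close> over one finite mixture; \<open>mixture_hull_bind\<close> and
  \<open>mixture_hullE\<close> are the two directions. Having the law as a coordinate ties these
  averages to quantities evaluated at the averaged law.\<close>

definition mixture_hull :: "('x::finite pmf \<Rightarrow> real) \<Rightarrow> ('x pmf \<Rightarrow> real) \<Rightarrow> ((real ^ 'x) \<times> real \<times> real) set" where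
  "mixture_hull f g = convex hull range (\<lambda>\<theta>. (pmf_vec \<theta>, f \<theta>, g \<theta>))"

lemma mixture_hull_bind:
  assumes "finite (set_pmf \<Lambda>)"
  shows "(pmf_vec (bind_pmf \<Lambda> \<theta>), measure_pmf.expectation \<Lambda> (\<lambda>t. f (\<theta> t)),
    measure_pmf.expectation \<Lambda> (\<lambda>t. g (\<theta> t))) \<in> mixture_hull f g"
proof -
  have "(\<Sum>t\<in>set_pmf \<Lambda>. pmf \<Lambda> t *\<^sub>R (pmf_vec (\<theta> t), f (\<theta> t), g (\<theta> t))) \<in> mixture_hull f g"
    unfolding mixture_hull_def
    by (intro convex_sum[OF assms convex_convex_hull sum_pmf_eq_1[OF assms order_refl]])
       (auto intro: hull_inc)
  also have "(\<Sum>t\<in>set_pmf \<Lambda>. pmf \<Lambda> t *\<^sub>R (pmf_vec (\<theta> t), f (\<theta> t), g (\<theta> t))) =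
    (pmf_vec (bind_pmf \<Lambda> \<theta>), measure_pmf.expectation \<Lambda> (\<lambda>t. f (\<theta> t)),
    measure_pmf.expectation \<Lambda> (\<lambda>t. g (\<theta> t)))"
    by (simp add: prod_eq_iff fst_sum snd_sum pmf_vec_bind[OF assms] integral_measure_pmf[OF assms])
  finally show ?thesis .
qed

text \<open>Labels come out as natural numbers below \<open>n\<close>, the form that the modular pad
  expects.\<close>

lemma mixture_hullE:
  assumes "(v, s, t) \<in> mixture_hull f g"
  obtains n :: nat and \<Lambda> and \<theta> where "set_pmf \<Lambda> \<subseteq> {..<n}" "v = pmf_vec (bind_pmf \<Lambda> \<theta>)"
    "s = measure_pmf.expectation \<Lambda> (\<lambda>t. f (\<theta> t))" "t = measure_pmf.expectation \<Lambda> (\<lambda>t. g (\<theta> t))"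
proof -
  from assms obtain k u x where ux: "\<forall>i\<in>{1::nat..k}. 0 \<le> u i \<and> x i \<in> range (\<lambda>\<theta>. (pmf_vec \<theta>, f \<theta>, g \<theta>))"
    and u: "sum u {1..k} = 1" and x: "(\<Sum>i = 1..k. u i *\<^sub>R x i) = (v, s, t)"
    unfolding mixture_hull_def convex_hull_indexed by auto
  have "\<forall>i\<in>{1..k}. \<exists>\<theta>. x i = (pmf_vec \<theta>, f \<theta>, g \<theta>)" using ux by auto
  then obtain \<theta> where \<theta>: "\<And>i. i \<in> {1..k} \<Longrightarrow> x i = (pmf_vec (\<theta> i), f (\<theta> i), g (\<theta> i))" by metis
  define w where "w = (\<lambda>i. if i \<in> {1..k} then u i else 0)"
  define \<Lambda> where "\<Lambda> = embed_pmf w"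
  have total: "(\<integral>\<^sup>+i. ennreal (w i) \<partial>count_space UNIV) = 1"
  proof -
    have "(\<integral>\<^sup>+i. ennreal (w i) \<partial>count_space UNIV) = (\<Sum>i\<in>{1..k}. ennreal (w i))"
      by (rule nn_integral_count_space'[of "{1..k}"]) (auto simp: w_def)
    also have "\<dots> = ennreal (\<Sum>i\<in>{1..k}. w i)"
      using ux by (intro sum_ennreal) (auto simp: w_def)
    also have "(\<Sum>i\<in>{1..k}. w i) = 1" using u by (simp add: w_def)
    finally show ?thesis by simp
  qed
  have pmf: "pmf \<Lambda> i = w i" for i
    unfolding \<Lambda>_def by (rule pmf_embed_pmf[OF _ total]) (use ux in \<open>auto simp: w_def\<close>)
  have supp: "set_pmf \<Lambda> \<subseteq> {1..k}"
    by (auto simp: set_pmf_iff pmf w_def split: if_splits)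
  then have fin: "finite (set_pmf \<Lambda>)" by (rule finite_subset) simp
  have E: "measure_pmf.expectation \<Lambda> h = (\<Sum>i = 1..k. u i * h i)" for h :: "nat \<Rightarrow> real"
    by (subst integral_measure_pmf[of "{1..k}"]) (use supp in \<open>auto simp: pmf w_def\<close>)
  have "pmf_vec (bind_pmf \<Lambda> \<theta>) = (\<Sum>i = 1..k. u i *\<^sub>R pmf_vec (\<theta> i))"
    unfolding pmf_vec_bind[OF fin]
    by (rule sum.mono_neutral_cong_left) (use supp in \<open>auto simp: pmf w_def set_pmf_iff split: if_splits\<close>)
  moreover have "v = fst (\<Sum>i = 1..k. u i *\<^sub>R x i)" "s = fst (snd (\<Sum>i = 1..k. u i *\<^sub>R x i))"
    "t = snd (snd (\<Sum>i = 1..k. u i *\<^sub>R x i))"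
    using x by auto
  ultimately have "v = pmf_vec (bind_pmf \<Lambda> \<theta>)" "s = measure_pmf.expectation \<Lambda> (\<lambda>t. f (\<theta> t))"
    "t = measure_pmf.expectation \<Lambda> (\<lambda>t. g (\<theta> t))"
    unfolding E by (simp_all add: fst_sum snd_sum \<theta>)
  \<comment> \<open>Hull indices run over 1..k, so the strict bound is \<open>Suc k\<close>; the
    label 0 has mass zero.\<close>
  moreover have "set_pmf \<Lambda> \<subseteq> {..<Suc k}" using supp by auto
  ultimately show ?thesis by (rule_tac that)
qed

lemma compact_mixture_hull:
  assumes "continuous_functional f" "continuous_functional g"
  shows "compact (mixture_hull f g)"
proof -
  from assms obtain F G where "continuous_on UNIV F" "\<And>\<theta>. f \<theta> = F (pmf_vec \<theta>)"
    "continuous_on UNIV G" "\<And>\<theta>. g \<theta> = G (pmf_vec \<theta>)"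
    unfolding continuous_functional_def by blast
  then have "range (\<lambda>\<theta>. (pmf_vec \<theta>, f \<theta>, g \<theta>)) = (\<lambda>v. (v, F v, G v)) ` range pmf_vec"
    and "continuous_on (range pmf_vec) (\<lambda>v. (v, F v, G v))"
    by (auto simp: image_image intro!: continuous_intros intro: continuous_on_subset)
  then show ?thesis
    unfolding mixture_hull_def
    by (auto intro!: compact_convex_hull compact_continuous_image compact_range_pmf_vec)
qed

text \<open>\<open>r1\<close>, \<open>r2\<close>, \<open>r0\<close> are taken at the averaged law
  and serve the terms that do not see the mixture; \<open>s\<close> and \<open>t\<close> are
  averages over it and serve the terms conditioned on both auxiliaries. Rates may be negative
  here.\<close>

definition rate_region ::
  "('x::finite pmf \<Rightarrow> real) \<Rightarrow> ('x pmf \<Rightarrow> real) \<Rightarrow> ('x pmf \<Rightarrow> real) \<Rightarrow> ('x pmf \<Rightarrow> real) \<Rightarrow>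
    ('x pmf \<Rightarrow> real) \<Rightarrow> (real \<times> real) set" where
  "rate_region r1 r2 r0 f g = {(R1, R2). \<exists>\<theta> s t. (pmf_vec \<theta>, s, t) \<in> mixture_hull f g \<and>
    R1 \<le> r1 \<theta> \<and> R2 \<le> r2 \<theta> \<and> R1 + R2 \<le> s \<and> R1 + R2 \<le> r0 \<theta> \<and> 0 \<le> t}"

lemma closed_rate_region:
  fixes r1 r2 r0 f g :: "'x::finite pmf \<Rightarrow> real"
  assumes cont: "continuous_functional r1" "continuous_functional r2" "continuous_functional r0"
    "continuous_functional f" "continuous_functional g"
  shows "closed (rate_region r1 r2 r0 f g)"
proof -
  from cont obtain E1 E2 E0 where E: "continuous_on UNIV E1" "\<And>\<theta>. r1 \<theta> = E1 (pmf_vec \<theta>)"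
    "continuous_on UNIV E2" "\<And>\<theta>. r2 \<theta> = E2 (pmf_vec \<theta>)"
    "continuous_on UNIV E0" "\<And>\<theta>. r0 \<theta> = E0 (pmf_vec \<theta>)"
    unfolding continuous_functional_def by metis
  let ?H = "mixture_hull f g"
  have E': "continuous_on UNIV (\<lambda>x :: ((real ^ 'x) \<times> real \<times> real) \<times> real \<times> real. E (fst (fst x)))"
    if "continuous_on UNIV E" for E :: "real ^ 'x \<Rightarrow> real"
    by (rule continuous_on_compose2[OF that]) (auto intro!: continuous_intros)
  let ?A = "{x :: ((real ^ 'x) \<times> real \<times> real) \<times> real \<times> real. fst (snd x) \<le> E1 (fst (fst x)) \<and> snd (snd x) \<le> E2 (fst (fst x)) \<and>
      fst (snd x) + snd (snd x) \<le> fst (snd (fst x)) \<and> fst (snd x) + snd (snd x) \<le> E0 (fst (fst x)) \<and>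
      0 \<le> snd (snd (fst x))}"
  have "closed ?A"
    using E'[OF E(1)] E'[OF E(3)] E'[OF E(5)]
    by (intro closed_Collect_conj closed_Collect_le) (auto intro!: continuous_intros)
  then have "closed {R. \<exists>x. x \<in> ?H \<and> (x, R) \<in> ?A}"
    by (rule closed_compact_projection[OF compact_mixture_hull[OF cont(4,5)]])
  moreover have "{R. \<exists>x. x \<in> ?H \<and> (x, R) \<in> ?A} = rate_region r1 r2 r0 f g"
  proof -
    \<comment> \<open>The hull stays over the simplex, so its first coordinate is always an input
      law.\<close>
    have "\<exists>\<theta>. v = pmf_vec \<theta>" if "(v, s, t) \<in> ?H" for v s t
      using mixture_hullE[OF that] by metis
    then show ?thesis
      unfolding rate_region_def by (fastforce simp: E)
  qed
  ultimately show ?thesis by simp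
qed

section \<open>Mutual information of finitely supported variables\<close>

text \<open>\<open>KL_divergence b P Q\<close> is D(Q || P). Only \<open>Q\<close> is concentrated
  on the finite set \<open>C\<close>; \<open>P\<close> may put mass elsewhere, as a product of
  marginals does.\<close>

lemma KL_divergence_finite:
  fixes P Q :: "'a measure"
  assumes b: "1 < b" and P: "finite_measure P" and Q: "prob_space Q" and sets: "sets Q = sets P"
    and C: "finite C" "\<And>c. c \<in> C \<Longrightarrow> {c} \<in> sets P" "measure Q C = 1"
    and pos: "\<And>c. c \<in> C \<Longrightarrow> 0 < measure P {c}"
  shows "KL_divergence b P Q = (\<Sum>c\<in>C. measure Q {c} * log b (measure Q {c} / measure P {c}))"
proof -
  interpret P: finite_measure P by (rule P)
  interpret Q: prob_space Q by (rule Q)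
  define r where "r = (\<lambda>c. measure Q {c} / measure P {c})"
  \<comment> \<open>\<open>h\<close> is the density of \<open>Q\<close> with respect to
    \<open>P\<close>: the ratio of point masses on \<open>C\<close>, and 0 off
    \<open>C\<close>.\<close>
  define h where "h = (\<lambda>x. \<Sum>c\<in>C. r c * indicator {c} x)"
  have r: "0 \<le> r c" if "c \<in> C" for c
    by (simp add: r_def)
  have h_in: "h x = r x" if "x \<in> C" for x
    using that C(1) by (simp add: h_def indicator_def if_distrib sum.delta cong: if_cong)
  have h_out: "h x = 0" if "x \<notin> C" for x
    using that by (auto simp: h_def indicator_def intro!: sum.neutral)
  have h_meas [measurable]: "h \<in> borel_measurable P"
    unfolding h_def using C(2) by (intro borel_measurable_sum borel_measurable_times borel_measurable_indicator) auto
  have CQ: "C \<in> sets Q"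
    using C(1,2) unfolding sets by (subst UN_singleton[symmetric]) (intro sets.finite_UN, auto)
  have "Q = density P h"
  proof (rule measure_eqI)
    fix A assume A: "A \<in> sets Q"
    have fin: "finite (A \<inter> C)" using C(1) by simp
    have "emeasure Q A = emeasure Q (A \<inter> C)"
    proof (rule emeasure_eq_AE)
      have "AE x in Q. x \<in> C"
        using C(3) CQ by (simp add: Q.AE_in_set_eq_1)
      then show "AE x in Q. (x \<in> A) = (x \<in> A \<inter> C)" by eventually_elim auto
    qed (use A CQ in auto)
    also have "\<dots> = (\<Sum>c\<in>A \<inter> C. emeasure Q {c})"
      using C(2) fin sets by (intro emeasure_eq_sum_singleton) auto
    also have "\<dots> = (\<Sum>c\<in>A \<inter> C. ennreal (r c) * emeasure P {c})"
      using pos by (intro sum.cong refl)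
        (auto simp: r_def P.emeasure_eq_measure Q.emeasure_eq_measure less_imp_neq[symmetric] simp flip: ennreal_mult)
    also have "\<dots> = (\<Sum>c\<in>C. ennreal (r c) * emeasure P ({c} \<inter> A))"
      using C(1) by (intro sum.mono_neutral_cong_left) (auto split: if_splits simp: Int_insert_left)
    also have "\<dots> = (\<Sum>c\<in>C. \<integral>\<^sup>+x. ennreal (r c) * indicator ({c} \<inter> A) x \<partial>P)"
      using A C(2) sets by (intro sum.cong refl nn_integral_cmult_indicator[symmetric]) auto
    also have "\<dots> = (\<integral>\<^sup>+x. (\<Sum>c\<in>C. ennreal (r c) * indicator ({c} \<inter> A) x) \<partial>P)"
      using A C(2) sets by (intro nn_integral_sum[symmetric]) auto
    also have "\<dots> = (\<integral>\<^sup>+x. ennreal (h x) * indicator A x \<partial>P)"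
    proof (rule nn_integral_cong)
      fix x
      have "(\<Sum>c\<in>C. ennreal (r c) * indicator ({c} \<inter> A) x) = (\<Sum>c\<in>C. if x = c then ennreal (r c) * indicator A x else 0)"
        by (intro sum.cong refl) (auto simp: indicator_def)
      also have "\<dots> = ennreal (h x) * indicator A x"
        using C(1) by (cases "x \<in> C") (simp_all add: h_in h_out)
      finally show "(\<Sum>c\<in>C. ennreal (r c) * indicator ({c} \<inter> A) x) = ennreal (h x) * indicator A x" .
    qed
    also have "\<dots> = emeasure (density P h) A"
      using A sets by (simp add: emeasure_density)
    finally show "emeasure Q A = emeasure (density P h) A" .
  qed (simp add: sets)
  then have "KL_divergence b P Q = (\<integral>x. h x * log b (h x) \<partial>P)"
    using P.KL_density[OF b h_meas] r by (simp add: h_def sum_nonneg)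
  also have "(\<lambda>x. h x * log b (h x)) = (\<lambda>x. \<Sum>c\<in>C. indicator {c} x * (r c * log b (r c)))"
  proof
    fix x
    have "(\<Sum>c\<in>C. indicator {c} x * (r c * log b (r c))) = (\<Sum>c\<in>C. if x = c then r c * log b (r c) else 0)"
      by (intro sum.cong refl) (auto simp: indicator_def)
    then show "h x * log b (h x) = (\<Sum>c\<in>C. indicator {c} x * (r c * log b (r c)))"
      using C(1) by (cases "x \<in> C") (simp_all add: h_in h_out)
  qed
  also have "(\<integral>x. (\<Sum>c\<in>C. indicator {c} x * (r c * log b (r c))) \<partial>P) =
      (\<Sum>c\<in>C. measure P {c} * (r c * log b (r c)))"
    using C(2) by (subst Bochner_Integration.integral_sum)
      (auto intro!: sum.cong integrable_real_mult_indicator simp: P.emeasure_eq_measure)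
  also have "\<dots> = (\<Sum>c\<in>C. measure Q {c} * log b (measure Q {c} / measure P {c}))"
    by (intro sum.cong refl) (use pos in \<open>auto simp: r_def less_imp_neq[symmetric]\<close>)
  finally show ?thesis .
qed

text \<open>The sigma-algebras enter only through measurability of single values, so Borel alphabets
  and their products are covered.\<close>

lemma mutual_information_measure_pmf:
  assumes b: "1 < b" and fin: "finite (set_pmf Q)"
    and X: "\<And>w. {X w} \<in> sets S"
    and Y: "\<And>w. {Y w} \<in> sets T"
  shows "prob_space.mutual_information (measure_pmf Q) b S T X Y =
    pmf_entropy b (map_pmf X Q) + pmf_entropy b (map_pmf Y Q) - pmf_entropy b (map_pmf (\<lambda>w. (X w, Y w)) Q)"
proof -
  note [simp] = integrable_measure_pmf_finite[OF fin]
  have [simp]: "X w \<in> space S" "Y w \<in> space T" for w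
    using sets.sets_into_space[OF X[of w]] sets.sets_into_space[OF Y[of w]] by auto
  have [measurable]: "X \<in> measurable (measure_pmf Q) S" "Y \<in> measurable (measure_pmf Q) T"
    "(\<lambda>w. (X w, Y w)) \<in> measurable (measure_pmf Q) (S \<Otimes>\<^sub>M T)"
    by (auto simp: space_pair_measure)
  let ?XY = "\<lambda>w. (X w, Y w)"
  let ?DX = "distr (measure_pmf Q) S X" and ?DY = "distr (measure_pmf Q) T Y"
    and ?D = "distr (measure_pmf Q) (S \<Otimes>\<^sub>M T) ?XY"
  interpret DX: prob_space ?DX by (rule measure_pmf.prob_space_distr) measurable
  interpret DY: prob_space ?DY by (rule measure_pmf.prob_space_distr) measurable
  interpret D: prob_space ?D by (rule measure_pmf.prob_space_distr) measurable
  interpret pair_prob_space ?DX ?DY ..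
  have single: "{?XY w} \<in> sets (S \<Otimes>\<^sub>M T)" for w
    using pair_measureI[OF X[of w] Y[of w]] by simp
  have mX: "measure ?DX {X w} = pmf (map_pmf X Q) (X w)" for w
    by (subst measure_distr) (auto simp: X pmf_map)
  have mY: "measure ?DY {Y w} = pmf (map_pmf Y Q) (Y w)" for w
    by (subst measure_distr) (auto simp: Y pmf_map)
  have mD: "measure ?D {?XY w} = pmf (map_pmf ?XY Q) (?XY w)" for w
    by (subst measure_distr) (auto simp: single pmf_map space_pair_measure)
  have mP: "measure (?DX \<Otimes>\<^sub>M ?DY) {?XY w} = pmf (map_pmf X Q) (X w) * pmf (map_pmf Y Q) (Y w)" for w
  proof -
    have "measure (?DX \<Otimes>\<^sub>M ?DY) ({X w} \<times> {Y w}) = measure ?DX {X w} * measure ?DY {Y w}"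
      using DY.emeasure_pair_measure_Times[of "{X w}" ?DX "{Y w}"] X[of w] Y[of w]
      by (simp add: measure_def enn2real_mult del: insert_Times_insert)
    then show ?thesis by (simp add: mX mY)
  qed
  have pos: "0 < pmf (map_pmf X Q) (X w)" "0 < pmf (map_pmf Y Q) (Y w)" "0 < pmf (map_pmf ?XY Q) (X w, Y w)"
    if "w \<in> set_pmf Q" for w
    using that by (auto intro!: pmf_positive)
  have "prob_space.mutual_information (measure_pmf Q) b S T X Y = KL_divergence b (?DX \<Otimes>\<^sub>M ?DY) ?D"
    by (simp add: prob_space.mutual_information_def[OF measure_pmf.prob_space_axioms])
  also have "\<dots> = (\<Sum>c\<in>?XY ` set_pmf Q. measure ?D {c} * log b (measure ?D {c} / measure (?DX \<Otimes>\<^sub>M ?DY) {c}))"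
  proof (rule KL_divergence_finite[OF b])
    have "?XY ` set_pmf Q \<in> sets (S \<Otimes>\<^sub>M T)"
      using single fin by (subst UN_singleton[symmetric]) (intro sets.finite_UN, auto)
    then show "measure ?D (?XY ` set_pmf Q) = 1"
      by (subst measure_distr) (auto simp: measure_pmf.prob_eq_1 AE_measure_pmf_iff space_pair_measure)
    show "sets ?D = sets (?DX \<Otimes>\<^sub>M ?DY)"
      by (simp cong: sets_pair_measure_cong)
    show "{c} \<in> sets (?DX \<Otimes>\<^sub>M ?DY)" if "c \<in> ?XY ` set_pmf Q" for c
      using that single by (auto cong: sets_pair_measure_cong)
    show "0 < measure (?DX \<Otimes>\<^sub>M ?DY) {c}" if "c \<in> ?XY ` set_pmf Q" for c
      using that pos mP by auto
  qed (auto simp: fin P.finite_measure_axioms D.prob_space_axioms)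
  also have "\<dots> = (\<Sum>c\<in>set_pmf (map_pmf ?XY Q). log b (pmf (map_pmf ?XY Q) c /
      (pmf (map_pmf X Q) (fst c) * pmf (map_pmf Y Q) (snd c))) * pmf (map_pmf ?XY Q) c)"
    unfolding set_map_pmf by (intro sum.cong refl) (auto simp: mD mP)
  also have "\<dots> = measure_pmf.expectation (map_pmf ?XY Q) (\<lambda>c. log b (pmf (map_pmf ?XY Q) c /
      (pmf (map_pmf X Q) (fst c) * pmf (map_pmf Y Q) (snd c))))"
    by (rule integral_measure_pmf_real[symmetric]) (use fin in auto)
  also have "\<dots> = measure_pmf.expectation Q (\<lambda>w. log b (pmf (map_pmf ?XY Q) (X w, Y w))
      - log b (pmf (map_pmf X Q) (X w)) - log b (pmf (map_pmf Y Q) (Y w)))"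
    unfolding integral_map_pmf
    by (intro integral_cong_AE)
       (use pos in \<open>auto simp: AE_measure_pmf_iff log_mult log_divide less_imp_neq[symmetric]\<close>)
  also have "\<dots> = pmf_entropy b (map_pmf X Q) + pmf_entropy b (map_pmf Y Q) - pmf_entropy b (map_pmf ?XY Q)"
    by (simp add: pmf_entropy_def)
  finally show ?thesis .
qed

text \<open>By definition I(X; Y | Z) = I(X; (Y, Z)) - I(X; Z), and the entropy of X
  cancels.\<close>

lemma conditional_mutual_information_measure_pmf:
  assumes b: "1 < b" and fin: "finite (set_pmf Q)"
    and Y: "\<And>w. {Y w} \<in> sets T"
    and Z: "\<And>w. {Z w} \<in> sets U"
  shows "prob_space.conditional_mutual_information (measure_pmf Q) b (count_space UNIV) T U X Y Z =
    cond_pmf_entropy b Q Y Z - cond_pmf_entropy b Q Y (\<lambda>w. (X w, Z w))"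
proof -
  have "{(Y w, Z w)} \<in> sets (T \<Otimes>\<^sub>M U)" for w
    using pair_measureI[OF Y[of w] Z[of w]] by simp
  moreover have "pmf_entropy b (map_pmf (\<lambda>w. (Y w, X w, Z w)) Q) = pmf_entropy b (map_pmf (\<lambda>w. (X w, Y w, Z w)) Q)"
    by (rule pmf_entropy_map_cong) auto
  ultimately show ?thesis
    unfolding prob_space.conditional_mutual_information_def[OF measure_pmf.prob_space_axioms]
    by (subst (1 2) mutual_information_measure_pmf[OF b fin]) (auto simp: Z cond_pmf_entropy_def)
qed

section \<open>The rate region and the one-time pad\<close>

definition mac_channel :: "('x1, 'x2, 'y, 'f1, 'f2) mac_gf \<Rightarrow> 'x1 \<times> 'x2 \<Rightarrow> ('y \<times> 'f1 \<times> 'f2) pmf" where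
  "mac_channel p = (\<lambda>(x1, x2). p x1 x2)"

text \<open>Since \<open>L\<close> is a function of the input \<open>x\<close>, \<open>information b q K L \<theta>\<close> is \<open>H(K | L) - H(K | x) = I(x; K | L)\<close>;
  the constant \<open>L = (\<lambda>_. ())\<close> stands for no conditioning. Likewise \<open>dependence_gain\<close> is
  \<open>I(x\<^sub>1; x\<^sub>2 | F) - I(x\<^sub>1; x\<^sub>2)\<close>, rewritten with entropies of \<open>F\<close> only.\<close>

definition input_entropy :: "real \<Rightarrow> ('x \<Rightarrow> 'z pmf) \<Rightarrow> ('z \<Rightarrow> 'k) \<Rightarrow> ('x \<Rightarrow> 'l) \<Rightarrow> 'x pmf \<Rightarrow> real" where
  "input_entropy b q K L \<theta> = cond_pmf_entropy b (channel_step q \<theta> id) (\<lambda>w. K (snd w)) (\<lambda>w. L (fst w))"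

definition information :: "real \<Rightarrow> ('x \<Rightarrow> 'z pmf) \<Rightarrow> ('z \<Rightarrow> 'k) \<Rightarrow> ('x \<Rightarrow> 'l) \<Rightarrow> 'x pmf \<Rightarrow> real" where
  "information b q K L \<theta> = input_entropy b q K L \<theta> - noise_entropy b q K \<theta>"

definition dependence_gain :: "real \<Rightarrow> ('x1 \<times> 'x2 \<Rightarrow> 'z pmf) \<Rightarrow> ('z \<Rightarrow> 'k) \<Rightarrow> ('x1 \<times> 'x2) pmf \<Rightarrow> real" where
  "dependence_gain b q F \<theta> = input_entropy b q F fst \<theta> + input_entropy b q F snd \<theta> -
    input_entropy b q F (\<lambda>_. ()) \<theta> - noise_entropy b q F \<theta>"

abbreviation receiver_and_second :: "'y \<times> 'f1 \<times> 'f2 \<Rightarrow> 'y \<times> 'f2" where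
  "receiver_and_second \<equiv> \<lambda>(y, u, v). (y, v)"

abbreviation receiver_and_first :: "'y \<times> 'f1 \<times> 'f2 \<Rightarrow> 'y \<times> 'f1" where
  "receiver_and_first \<equiv> \<lambda>(y, u, v). (y, u)"

text \<open>The last two arguments are averaged over the mixture. On outputs, \<open>fst\<close>
  selects Y and \<open>snd\<close> the pair of feedbacks; on inputs they select a
  transmitter.\<close>

definition mac_region :: "real \<Rightarrow> ('x1::finite, 'x2::finite, 'y::finite, 'f1::finite, 'f2::finite) mac_gf \<Rightarrow> (real \<times> real) set" where
  "mac_region b p = rate_region (information b (mac_channel p) receiver_and_second snd)
    (information b (mac_channel p) receiver_and_first fst)
    (information b (mac_channel p) fst (\<lambda>_. ()))
    (information b (mac_channel p) id (\<lambda>_. ()))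
    (dependence_gain b (mac_channel p) snd)"

lemma continuous_functional_input_entropy:
  fixes q :: "'x::finite \<Rightarrow> 'z::finite pmf" and K :: "'z \<Rightarrow> 'k::finite" and L :: "'x \<Rightarrow> 'l::finite"
  shows "continuous_functional (input_entropy b q K L)"
  unfolding input_entropy_def by (rule continuous_functional_cond_entropy)

lemma continuous_functional_information:
  fixes q :: "'x::finite \<Rightarrow> 'z::finite pmf" and K :: "'z \<Rightarrow> 'k::finite" and L :: "'x \<Rightarrow> 'l::finite"
  shows "continuous_functional (information b q K L)"
  unfolding information_def
  by (intro continuous_functional_diff continuous_functional_input_entropy continuous_functional_noise_entropy)

lemma closed_mac_region: "closed (mac_region b p)"
  unfolding mac_region_def dependence_gain_def
  by (intro closed_rate_region continuous_functional_information continuous_functional_diff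
      continuous_functional_add continuous_functional_input_entropy continuous_functional_noise_entropy)

section \<open>Splitting a label into two uniform shares\<close>

lemma map_shift_uniform:
  assumes "0 < (n::nat)"
  shows "map_pmf (\<lambda>u. (k + u) mod n) (pmf_of_set {..<n}) = pmf_of_set {..<n}"
proof (rule map_pmf_of_set_bij_betw)
  have "inj_on (\<lambda>u. (k + u) mod n) {..<n}"
  proof (rule inj_onI)
    fix u v assume uv: "u \<in> {..<n}" "v \<in> {..<n}" and "(k + u) mod n = (k + v) mod n"
    then have "[k + u = k + v] (mod n)" by (simp add: cong_def)
    then have "[u = v] (mod n)" by (simp add: cong_add_lcancel_nat)
    with uv show "u = v" by (simp add: cong_def)
  qed
  moreover have "(\<lambda>u. (k + u) mod n) ` {..<n} \<subseteq> {..<n}" using assms by auto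
  ultimately show "bij_betw (\<lambda>u. (k + u) mod n) {..<n} {..<n}"
    by (simp add: bij_betw_def endo_inj_surj)
qed (use assms in auto)

text \<open>The label \<open>fst w\<close> is dropped and survives only in the two shares together;
  the payload passes through unchanged.\<close>

definition padded :: "nat \<Rightarrow> (nat \<times> 'a) pmf \<Rightarrow> ((nat \<times> nat) \<times> 'a) pmf" where
  "padded n B = bind_pmf B (\<lambda>w. map_pmf (\<lambda>u. ((u, (fst w + u) mod n), snd w)) (pmf_of_set {..<n}))"

lemma finite_set_pmf_padded:
  "0 < n \<Longrightarrow> finite (set_pmf B) \<Longrightarrow> finite (set_pmf (padded n B))"
  by (simp add: padded_def lessThan_empty_iff)

lemma map_fst_padded:
  "map_pmf (\<lambda>w. (fst (fst w), A (snd w))) (padded n B) = pair_pmf (pmf_of_set {..<n}) (map_pmf (\<lambda>w. A (snd w)) B)"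
  by (subst pair_commute_pmf)
     (simp add: padded_def map_bind_pmf map_pmf_comp pair_pmf_def bind_map_pmf map_pmf_def bind_assoc_pmf bind_return_pmf)

lemma map_snd_padded:
  assumes "0 < n"
  shows "map_pmf (\<lambda>w. (snd (fst w), A (snd w))) (padded n B) = pair_pmf (pmf_of_set {..<n}) (map_pmf (\<lambda>w. A (snd w)) B)"
proof -
  have "map_pmf (\<lambda>w. (snd (fst w), A (snd w))) (padded n B) =
      bind_pmf B (\<lambda>w. map_pmf (\<lambda>u. (u, A (snd w))) (map_pmf (\<lambda>u. (fst w + u) mod n) (pmf_of_set {..<n})))"
    by (simp add: padded_def map_bind_pmf map_pmf_comp)
  also have "\<dots> = bind_pmf B (\<lambda>w. map_pmf (\<lambda>u. (u, A (snd w))) (pmf_of_set {..<n}))"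
    by (simp add: map_shift_uniform[OF assms])
  also have "\<dots> = pair_pmf (pmf_of_set {..<n}) (map_pmf (\<lambda>w. A (snd w)) B)"
    by (subst pair_commute_pmf)
       (simp add: map_pmf_comp pair_pmf_def bind_map_pmf map_pmf_def bind_assoc_pmf bind_return_pmf)
  finally show ?thesis .
qed

lemma map_payload_padded: "map_pmf (\<lambda>w. h (snd w)) (padded n B) = map_pmf (\<lambda>w. h (snd w)) B"
  by (simp add: padded_def map_bind_pmf map_pmf_comp map_pmf_const flip: map_pmf_def)

text \<open>One share is uniform and independent of the payload, so its entropy adds to both joint
  entropies and cancels. The independence is assumed at two payload types because a hypothesis
  cannot be polymorphic.\<close>

lemma cond_entropy_padded_single:
  assumes n: "0 < n" and fin: "finite (set_pmf B)"
    and i: "\<And>A :: 'a \<Rightarrow> 'k \<times> 'l. map_pmf (\<lambda>w. (pad w, A (snd w))) (padded n B) =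
      pair_pmf (pmf_of_set {..<n}) (map_pmf (\<lambda>w. A (snd w)) B)"
    "\<And>A :: 'a \<Rightarrow> 'l. map_pmf (\<lambda>w. (pad w, A (snd w))) (padded n B) =
      pair_pmf (pmf_of_set {..<n}) (map_pmf (\<lambda>w. A (snd w)) B)"
  shows "cond_pmf_entropy b (padded n B) (\<lambda>w. K (snd w)) (\<lambda>w. (L (snd w), pad w)) =
    cond_pmf_entropy b B (\<lambda>w. (K :: 'a \<Rightarrow> 'k) (snd w)) (\<lambda>w. (L :: 'a \<Rightarrow> 'l) (snd w))"
proof -
  have "pmf_entropy b (map_pmf (\<lambda>w. (K (snd w), L (snd w), pad w)) (padded n B)) =
      pmf_entropy b (map_pmf (\<lambda>w. (pad w, (K (snd w), L (snd w)))) (padded n B))"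
    by (rule pmf_entropy_map_cong) auto
  moreover have "pmf_entropy b (map_pmf (\<lambda>w. (L (snd w), pad w)) (padded n B)) =
      pmf_entropy b (map_pmf (\<lambda>w. (pad w, L (snd w))) (padded n B))"
    by (rule pmf_entropy_map_cong) auto
  ultimately show ?thesis
    using i(1)[of "\<lambda>w. (K w, L w)"] i(2)[of L] n fin
    by (simp add: cond_pmf_entropy_def pmf_entropy_pair lessThan_empty_iff)
qed

lemma mod_shift_eq_iff:
  fixes i j u n :: nat
  assumes "i < n" "j < n"
  shows "(i + u) mod n = (j + u) mod n \<longleftrightarrow> i = j"
proof
  assume "(i + u) mod n = (j + u) mod n"
  then have "[i + u = j + u] (mod n)" by (simp add: cong_def)
  then have "[i = j] (mod n)" by (simp add: cong_add_rcancel_nat)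
  with assms show "i = j" by (simp add: cong_def)
qed simp

text \<open>Since labels are below \<open>n\<close>, the two shares amount to the label and an
  independent uniform number, whose entropy cancels.\<close>

lemma cond_entropy_padded_both:
  fixes B :: "(nat \<times> 'a) pmf"
  assumes n: "0 < n" and fin: "finite (set_pmf B)" and less: "\<And>w. w \<in> set_pmf B \<Longrightarrow> fst w < n"
  shows "cond_pmf_entropy b (padded n B) (\<lambda>w. K (snd w)) (\<lambda>w. (L (snd w), fst w)) =
    cond_pmf_entropy b B (\<lambda>w. K (snd w)) (\<lambda>w. (L (snd w), fst w))"
proof -
  let ?R = "bind_pmf B (\<lambda>w. map_pmf (Pair w) (pmf_of_set {..<n}))"
  have pad: "padded n B = map_pmf (\<lambda>(w, u). ((u, (fst w + u) mod n), snd w)) ?R"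
    by (simp add: padded_def map_bind_pmf map_pmf_comp)
  have R: "?R = pair_pmf B (pmf_of_set {..<n})"
    by (simp add: pair_pmf_def map_pmf_def)
  have ent: "pmf_entropy b (map_pmf (\<lambda>w. (A (snd w), fst w)) (padded n B)) =
      pmf_entropy b (map_pmf (\<lambda>w. (A (snd w), fst w)) B) + pmf_entropy b (pmf_of_set {..<n})"
    for A :: "'a \<Rightarrow> 'e"
  proof -
    have "pmf_entropy b (map_pmf (\<lambda>w. (A (snd w), fst w)) (padded n B)) =
        pmf_entropy b (map_pmf (\<lambda>(w, u). ((A (snd w), fst w), u)) ?R)"
      unfolding pad map_pmf_comp
      by (rule pmf_entropy_map_cong) (use less in \<open>auto simp: mod_shift_eq_iff\<close>)
    also have "map_pmf (\<lambda>(w, u). ((A (snd w), fst w), u)) ?R =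
        pair_pmf (map_pmf (\<lambda>w. (A (snd w), fst w)) B) (pmf_of_set {..<n})"
      unfolding R by (simp add: pair_map_pmf1 case_prod_beta' apfst_def map_prod_def)
    finally show ?thesis using n fin by (simp add: pmf_entropy_pair lessThan_empty_iff)
  qed
  have 1: "pmf_entropy b (map_pmf (\<lambda>w. (K (snd w), L (snd w), fst w)) P) =
      pmf_entropy b (map_pmf (\<lambda>w. ((K (snd w), L (snd w)), fst w)) P)" for P :: "('p \<times> 'a) pmf"
    by (rule pmf_entropy_map_cong) auto
  show ?thesis
    unfolding cond_pmf_entropy_def 1 ent using ent[of "\<lambda>a. (K a, L a)"] by simp
qed

section \<open>From the rate region to admissible random variables\<close>

lemma input_entropy_id:
  fixes q :: "'x::finite \<Rightarrow> 'z::finite pmf"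
  shows "input_entropy b q K id \<theta> = noise_entropy b q K \<theta>"
  using cond_entropy_channel_step_full[of \<theta> b q id K]
  by (simp add: input_entropy_def pmf.map_id)

text \<open>This yields the product form demanded by \<open>mac_gf_variables\<close>;
  \<open>S\<close> will test whether the pair of shares lies in a measurable set.\<close>

lemma prob_channel_step:
  fixes q :: "'x \<Rightarrow> 'z::finite pmf"
  assumes "finite (set_pmf P)"
  shows "measure_pmf.prob (channel_step q P X) {w. S (fst w) \<and> X (fst w) = x \<and> snd w = z} =
    measure_pmf.prob P {a. S a \<and> X a = x} * pmf (q x) z"
proof -
  let ?A = "{w. S (fst w) \<and> X (fst w) = x \<and> snd w = z}"
  have "measure_pmf.prob (channel_step q P X) ?A = measure_pmf.expectation (channel_step q P X) (indicator ?A)"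
    by simp
  also have "\<dots> = measure_pmf.expectation P (\<lambda>a. measure_pmf.expectation (map_pmf (Pair a) (q (X a))) (indicator ?A))"
    unfolding channel_step_def by (rule expectation_bind_pmf_finite) (use assms in auto)
  also have "\<dots> = measure_pmf.expectation P (\<lambda>a. indicator {a. S a \<and> X a = x} a * pmf (q x) z)"
  proof (intro Bochner_Integration.integral_cong refl)
    fix a
    have "(\<lambda>z'. indicator ?A (a, z')) = (\<lambda>z'. indicator {a. S a \<and> X a = x} a * indicator {z} z' :: real)"
      by (auto simp: indicator_def fun_eq_iff)
    then show "measure_pmf.expectation (map_pmf (Pair a) (q (X a))) (indicator ?A) =
        indicator {a. S a \<and> X a = x} a * pmf (q x) z"
      by (auto simp: measure_pmf_single indicator_def)
  qed
  finally show ?thesis by simp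
qed

text \<open>The terms are matched with equality: conditioning on one share leaves the averaged law,
  conditioning on both exposes the mixture, and the gap in the balance inequality is exactly
  \<open>t\<close>.\<close>

lemma mac_region_subset_DB_MAC:
  fixes p :: "('x1::finite, 'x2::finite, 'y::finite, 'f1::finite, 'f2::finite) mac_gf"
  assumes b: "1 < b" and R: "(R1, R2) \<in> mac_region b p" "0 \<le> R1" "0 \<le> R2"
  shows "(R1, R2) \<in> DB_MAC b p"
proof -
  let ?q = "mac_channel p"
  from R(1) obtain \<theta> s t where hull: "(pmf_vec \<theta>, s, t) \<in>
      mixture_hull (information b ?q id (\<lambda>_. ())) (dependence_gain b ?q snd)"
    and R1: "R1 \<le> information b ?q receiver_and_second snd \<theta>"
    and R2: "R2 \<le> information b ?q receiver_and_first fst \<theta>"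
    and Rs: "R1 + R2 \<le> s" and R0: "R1 + R2 \<le> information b ?q fst (\<lambda>_. ()) \<theta>" and t: "0 \<le> t"
    unfolding mac_region_def rate_region_def mem_Collect_eq prod.case by blast
  from hull obtain n :: nat and \<Lambda> \<Theta> where supp: "set_pmf \<Lambda> \<subseteq> {..<n}"
    and \<theta>': "pmf_vec \<theta> = pmf_vec (bind_pmf \<Lambda> \<Theta>)"
    and s: "s = measure_pmf.expectation \<Lambda> (\<lambda>k. information b ?q id (\<lambda>_. ()) (\<Theta> k))"
    and t': "t = measure_pmf.expectation \<Lambda> (\<lambda>k. dependence_gain b ?q snd (\<Theta> k))"
    by (rule mixture_hullE)
  note \<theta> = \<theta>'[unfolded pmf_vec_inject]
  have fin\<Lambda>: "finite (set_pmf \<Lambda>)" using supp by (rule finite_subset) simp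
  note [simp] = integrable_measure_pmf_finite[OF fin\<Lambda>]
  have n: "0 < n" using supp set_pmf_not_empty[of \<Lambda>] by (cases n) auto
  define P where "P = padded n (bind_pmf \<Lambda> (\<lambda>k. map_pmf (Pair k) (\<Theta> k)))"
  define B where "B = bind_pmf \<Lambda> (\<lambda>k. map_pmf (Pair k) (channel_step ?q (\<Theta> k) id))"
  define W where "W = padded n B"
  have finP: "finite (set_pmf P)"
    unfolding P_def by (rule finite_set_pmf_padded) (use n fin\<Lambda> in auto)
  have finB: "finite (set_pmf B)"
    unfolding B_def by (simp add: fin\<Lambda> finite_set_pmf_channel_step)
  have finW: "finite (set_pmf W)"
    unfolding W_def by (rule finite_set_pmf_padded[OF n finB])
  \<comment> \<open>Padding and channel use commute, because the pad leaves the input untouched.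
    \<open>W\<close> as a padded mixture serves the entropies; \<open>W\<close> as a channel use
    after padded inputs gives the factorization.\<close>
  have W: "W = map_pmf (\<lambda>w. (fst (fst w), snd (fst w), snd w)) (channel_step ?q P snd)"
    unfolding W_def B_def P_def padded_def channel_step_def
    by (simp add: map_pmf_def bind_assoc_pmf bind_return_pmf, intro bind_pmf_cong refl,
        subst bind_commute_pmf[of "pmf_of_set {..<n}"], intro bind_pmf_cong refl)
  have sndB: "map_pmf (\<lambda>w. h (snd w)) B = map_pmf h (channel_step ?q \<theta> id)" for h :: "_ \<Rightarrow> 'h"
    unfolding B_def \<theta> by (simp add: map_bind_pmf map_pmf_comp channel_step_def bind_assoc_pmf)
  have single: "cond_pmf_entropy b W (\<lambda>w. K (snd (snd w))) (\<lambda>w. (L (fst (snd w)), pad (fst w))) = input_entropy b ?q K L \<theta>"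
    if "pad = fst \<or> pad = snd" for pad and K :: "'y \<times> 'f1 \<times> 'f2 \<Rightarrow> 'k" and L :: "'x1 \<times> 'x2 \<Rightarrow> 'l"
  proof -
    have "cond_pmf_entropy b W (\<lambda>w. K (snd (snd w))) (\<lambda>w. (L (fst (snd w)), pad (fst w))) =
        cond_pmf_entropy b B (\<lambda>w. K (snd (snd w))) (\<lambda>w. L (fst (snd w)))"
      unfolding W_def
      by (rule cond_entropy_padded_single[OF n finB, where K="\<lambda>w. K (snd w)" and L="\<lambda>w. L (fst w)"])
         (use that map_fst_padded map_snd_padded[OF n] in auto)
    also have "\<dots> = input_entropy b ?q K L \<theta>"
      using sndB[of "\<lambda>w. (K (snd w), L (fst w))"] sndB[of "\<lambda>w. L (fst w)"]
      by (simp add: input_entropy_def cond_pmf_entropy_def)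
    finally show ?thesis .
  qed
  have both: "cond_pmf_entropy b W (\<lambda>w. K (snd (snd w))) (\<lambda>w. (L (fst (snd w)), fst w)) =
      measure_pmf.expectation \<Lambda> (\<lambda>k. input_entropy b ?q K L (\<Theta> k))"
    for K :: "'y \<times> 'f1 \<times> 'f2 \<Rightarrow> 'k" and L :: "'x1 \<times> 'x2 \<Rightarrow> 'l"
  proof -
    have "cond_pmf_entropy b W (\<lambda>w. K (snd (snd w))) (\<lambda>w. (L (fst (snd w)), fst w)) =
        cond_pmf_entropy b B (\<lambda>w. K (snd (snd w))) (\<lambda>w. (L (fst (snd w)), fst w))"
      unfolding W_def
      by (rule cond_entropy_padded_both[OF n finB, where K="\<lambda>w. K (snd w)" and L="\<lambda>w. L (fst w)"])
         (use supp in \<open>auto simp: B_def\<close>)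
    also have "\<dots> = measure_pmf.expectation \<Lambda> (\<lambda>k. input_entropy b ?q K L (\<Theta> k))"
      unfolding B_def input_entropy_def
      using cond_pmf_entropy_mixture[OF fin\<Lambda>, where R="\<lambda>k. channel_step ?q (\<Theta> k) id" and b=b
          and X="\<lambda>w. K (snd w)" and Y="\<lambda>w. L (fst w)"]
      by (simp add: finite_set_pmf_channel_step case_prod_unfold)
    finally show ?thesis .
  qed
  \<comment> \<open>Shares are stored as reals and the tuple is reshaped into the sample space that
    \<open>DB_MAC\<close> prescribes. The map is injective, so entropies are unaffected.\<close>
  define e where "e = (\<lambda>((t1 :: nat, t2 :: nat), (x1 :: 'x1, x2 :: 'x2), (y :: 'y, u :: 'f1, v :: 'f2)).
    (real t1, real t2, x1, x2, y, u, v))"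
  define Q where "Q = map_pmf e W"
  define T1 T2 where "T1 = (\<lambda>\<omega>. fst (\<omega> :: real \<times> real \<times> 'x1 \<times> 'x2 \<times> 'y \<times> 'f1 \<times> 'f2))"
    and "T2 = (\<lambda>\<omega>. fst (snd (\<omega> :: real \<times> real \<times> 'x1 \<times> 'x2 \<times> 'y \<times> 'f1 \<times> 'f2)))"
  define X1 X2 where "X1 = (\<lambda>\<omega>. fst (snd (snd (\<omega> :: real \<times> real \<times> 'x1 \<times> 'x2 \<times> 'y \<times> 'f1 \<times> 'f2))))"
    and "X2 = (\<lambda>\<omega>. fst (snd (snd (snd (\<omega> :: real \<times> real \<times> 'x1 \<times> 'x2 \<times> 'y \<times> 'f1 \<times> 'f2)))))"
  define Y F1 F2 where "Y = (\<lambda>\<omega>. fst (snd (snd (snd (snd (\<omega> :: real \<times> real \<times> 'x1 \<times> 'x2 \<times> 'y \<times> 'f1 \<times> 'f2))))))"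
    and "F1 = (\<lambda>\<omega>. fst (snd (snd (snd (snd (snd (\<omega> :: real \<times> real \<times> 'x1 \<times> 'x2 \<times> 'y \<times> 'f1 \<times> 'f2)))))))"
    and "F2 = (\<lambda>\<omega>. snd (snd (snd (snd (snd (snd (\<omega> :: real \<times> real \<times> 'x1 \<times> 'x2 \<times> 'y \<times> 'f1 \<times> 'f2)))))))"
  note coord_defs = T1_def T2_def X1_def X2_def Y_def F1_def F2_def
  have coords [simp]: "T1 (e w) = real (fst (fst w))" "T2 (e w) = real (snd (fst w))"
    "X1 (e w) = fst (fst (snd w))" "X2 (e w) = snd (fst (snd w))"
    "Y (e w) = fst (snd (snd w))" "F1 (e w) = fst (snd (snd (snd w)))" "F2 (e w) = snd (snd (snd (snd w)))" for w
    by (simp_all add: coord_defs e_def split: prod.splits)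
  have finQ: "finite (set_pmf Q)" by (simp add: Q_def finW)
  have vars: "mac_gf_variables p (measure_pmf Q) borel borel T1 T2 X1 X2 Y F1 F2"
    unfolding mac_gf_variables_def
  proof (intro conjI ballI allI)
    fix A :: "(real \<times> real) set" and x1 x2 y u v
    let ?S = "\<lambda>a :: (nat \<times> nat) \<times> 'x1 \<times> 'x2. (real (fst (fst a)), real (snd (fst a))) \<in> A"
    have "measure_pmf.prob Q {\<omega> \<in> space Q. (T1 \<omega>, T2 \<omega>) \<in> A \<and> X1 \<omega> = x1 \<and> X2 \<omega> = x2 \<and> Y \<omega> = y \<and> F1 \<omega> = u \<and> F2 \<omega> = v} =
        measure_pmf.prob (channel_step ?q P snd) {w. ?S (fst w) \<and> snd (fst w) = (x1, x2) \<and> snd w = (y, u, v)}"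
      unfolding Q_def W map_pmf_comp measure_map_pmf
      by (intro arg_cong2[where f=measure] refl) (auto simp: prod_eq_iff)
    also have "\<dots> = measure_pmf.prob P {a. ?S a \<and> snd a = (x1, x2)} * pmf (?q (x1, x2)) (y, u, v)"
      by (rule prob_channel_step[OF finP])
    also have "measure_pmf.prob P {a. ?S a \<and> snd a = (x1, x2)} =
        measure_pmf.prob (map_pmf fst (channel_step ?q P snd)) {a. ?S a \<and> snd a = (x1, x2)}"
      using map_fst_channel_step[of "\<lambda>x. x" ?q P snd] by (simp add: pmf.map_ident)
    also have "\<dots> = measure_pmf.prob Q {\<omega> \<in> space Q. (T1 \<omega>, T2 \<omega>) \<in> A \<and> X1 \<omega> = x1 \<and> X2 \<omega> = x2}"
      unfolding Q_def W map_pmf_comp measure_map_pmf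
      by (intro arg_cong2[where f=measure] refl) (auto simp: prod_eq_iff)
    finally show "measure_pmf.prob Q {\<omega> \<in> space Q. (T1 \<omega>, T2 \<omega>) \<in> A \<and> X1 \<omega> = x1 \<and> X2 \<omega> = x2 \<and> Y \<omega> = y \<and> F1 \<omega> = u \<and> F2 \<omega> = v} =
        measure_pmf.prob Q {\<omega> \<in> space Q. (T1 \<omega>, T2 \<omega>) \<in> A \<and> X1 \<omega> = x1 \<and> X2 \<omega> = x2} * pmf (p x1 x2) (y, u, v)"
      by (simp add: mac_channel_def)
  qed (auto simp: measure_pmf.prob_space_axioms)
  have pairs: "{(a, c)} \<in> sets (S \<Otimes>\<^sub>M T)" if "{a} \<in> sets S" "{c} \<in> sets T" for a c S T
    using pair_measureI[OF that] by simp
  note cmi = conditional_mutual_information_measure_pmf[OF b finQ]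
  have "prob_space.conditional_mutual_information Q b (count_space UNIV) (count_space UNIV) (count_space UNIV \<Otimes>\<^sub>M borel)
       X1 (\<lambda>\<omega>. (Y \<omega>, F2 \<omega>)) (\<lambda>\<omega>. (X2 \<omega>, T2 \<omega>)) = information b ?q receiver_and_second snd \<theta>"
  proof -
    have "cond_pmf_entropy b Q (\<lambda>\<omega>. (Y \<omega>, F2 \<omega>)) (\<lambda>\<omega>. (X2 \<omega>, T2 \<omega>)) =
        cond_pmf_entropy b W (\<lambda>w. receiver_and_second (snd (snd w))) (\<lambda>w. (snd (fst (snd w)), snd (fst w)))"
      unfolding Q_def cond_pmf_entropy_map by (rule cond_pmf_entropy_cong) auto
    \<comment> \<open>With both inputs in the condition the full input is known, hence
      \<open>id\<close>; \<open>input_entropy_id\<close> identifies the value with the noise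
      entropy.\<close>
    moreover have "cond_pmf_entropy b Q (\<lambda>\<omega>. (Y \<omega>, F2 \<omega>)) (\<lambda>\<omega>. (X1 \<omega>, X2 \<omega>, T2 \<omega>)) =
        cond_pmf_entropy b W (\<lambda>w. receiver_and_second (snd (snd w))) (\<lambda>w. (id (fst (snd w)), snd (fst w)))"
      unfolding Q_def cond_pmf_entropy_map by (rule cond_pmf_entropy_cong) auto
    ultimately show ?thesis
      using single[of snd receiver_and_second snd] single[of snd receiver_and_second id]
      by (subst cmi) (auto intro!: pairs simp: information_def input_entropy_id[symmetric])
  qed
  moreover have "prob_space.conditional_mutual_information Q b (count_space UNIV) (count_space UNIV) (count_space UNIV \<Otimes>\<^sub>M borel)
       X2 (\<lambda>\<omega>. (Y \<omega>, F1 \<omega>)) (\<lambda>\<omega>. (X1 \<omega>, T1 \<omega>)) = information b ?q receiver_and_first fst \<theta>"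
  proof -
    have "cond_pmf_entropy b Q (\<lambda>\<omega>. (Y \<omega>, F1 \<omega>)) (\<lambda>\<omega>. (X1 \<omega>, T1 \<omega>)) =
        cond_pmf_entropy b W (\<lambda>w. receiver_and_first (snd (snd w))) (\<lambda>w. (fst (fst (snd w)), fst (fst w)))"
      unfolding Q_def cond_pmf_entropy_map by (rule cond_pmf_entropy_cong) auto
    moreover have "cond_pmf_entropy b Q (\<lambda>\<omega>. (Y \<omega>, F1 \<omega>)) (\<lambda>\<omega>. (X2 \<omega>, X1 \<omega>, T1 \<omega>)) =
        cond_pmf_entropy b W (\<lambda>w. receiver_and_first (snd (snd w))) (\<lambda>w. (id (fst (snd w)), fst (fst w)))"
      unfolding Q_def cond_pmf_entropy_map by (rule cond_pmf_entropy_cong) auto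
    ultimately show ?thesis
      using single[of fst receiver_and_first fst] single[of fst receiver_and_first id]
      by (subst cmi) (auto intro!: pairs simp: information_def input_entropy_id[symmetric])
  qed
  moreover have "prob_space.conditional_mutual_information Q b (count_space UNIV) (count_space UNIV) (borel \<Otimes>\<^sub>M borel)
       (\<lambda>\<omega>. (X1 \<omega>, X2 \<omega>)) (\<lambda>\<omega>. (Y \<omega>, F1 \<omega>, F2 \<omega>)) (\<lambda>\<omega>. (T1 \<omega>, T2 \<omega>)) = s"
  proof -
    have "cond_pmf_entropy b Q (\<lambda>\<omega>. (Y \<omega>, F1 \<omega>, F2 \<omega>)) (\<lambda>\<omega>. (T1 \<omega>, T2 \<omega>)) =
        cond_pmf_entropy b W (\<lambda>w. id (snd (snd w))) (\<lambda>w. ((\<lambda>_. ()) (fst (snd w)), fst w))"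
      unfolding Q_def cond_pmf_entropy_map by (rule cond_pmf_entropy_cong) (auto simp: prod_eq_iff)
    moreover have "cond_pmf_entropy b Q (\<lambda>\<omega>. (Y \<omega>, F1 \<omega>, F2 \<omega>)) (\<lambda>\<omega>. ((X1 \<omega>, X2 \<omega>), (T1 \<omega>, T2 \<omega>))) =
        cond_pmf_entropy b W (\<lambda>w. id (snd (snd w))) (\<lambda>w. (id (fst (snd w)), fst w))"
      unfolding Q_def cond_pmf_entropy_map by (rule cond_pmf_entropy_cong) (auto simp: prod_eq_iff)
    ultimately show ?thesis
      using both[of id "\<lambda>_. ()"] both[of id id]
      unfolding s by (subst cmi) (auto intro!: pairs simp: information_def input_entropy_id[symmetric])
  qed
  moreover have "prob_space.mutual_information Q b (count_space UNIV) (count_space UNIV)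
      (\<lambda>\<omega>. (X1 \<omega>, X2 \<omega>)) Y = information b ?q fst (\<lambda>_. ()) \<theta>"
  proof -
    \<comment> \<open>No auxiliary occurs in this term, so only the payload law matters, and that is
      one channel use at the averaged law.\<close>
    have map: "map_pmf (\<lambda>\<omega>. ((X1 \<omega>, X2 \<omega>), Y \<omega>)) Q = map_pmf (\<lambda>w. (fst w, fst (snd w))) (channel_step ?q \<theta> id)"
      using map_payload_padded[of "\<lambda>w. (fst w, fst (snd w))" n B] sndB[of "\<lambda>w. (fst w, fst (snd w))"]
      by (simp add: Q_def map_pmf_comp W_def)
    have 1: "map_pmf (\<lambda>\<omega>. (X1 \<omega>, X2 \<omega>)) Q = map_pmf fst (channel_step ?q \<theta> id)"
      using arg_cong[OF map, of "map_pmf fst"] by (simp add: map_pmf_comp)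
    have 2: "map_pmf Y Q = map_pmf (\<lambda>w. fst (snd w)) (channel_step ?q \<theta> id)"
      using arg_cong[OF map, of "map_pmf snd"] by (simp add: map_pmf_comp)
    have 3: "pmf_entropy b (map_pmf (\<lambda>w. (fst w, fst (snd w))) (channel_step ?q \<theta> id)) =
        pmf_entropy b (map_pmf (\<lambda>w. (fst (snd w), id (fst w))) (channel_step ?q \<theta> id))"
      by (rule pmf_entropy_map_cong) auto
    have 4: "pmf_entropy b (map_pmf (\<lambda>w. fst (snd w)) (channel_step ?q \<theta> id)) =
        pmf_entropy b (map_pmf (\<lambda>w. (fst (snd w), ())) (channel_step ?q \<theta> id))"
      by (rule pmf_entropy_map_cong) auto
    have 5: "pmf_entropy b (return_pmf ()) = 0"
      by (simp add: pmf_entropy_def)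
    have "information b ?q fst (\<lambda>_. ()) \<theta> = input_entropy b ?q fst (\<lambda>_. ()) \<theta> - input_entropy b ?q fst id \<theta>"
      by (simp add: information_def input_entropy_id)
    then show ?thesis
      by (subst mutual_information_measure_pmf[OF b finQ])
         (simp_all add: map 1 2 3 4 5 input_entropy_def cond_pmf_entropy_def)
  qed
  moreover have "prob_space.conditional_mutual_information Q b (count_space UNIV) (count_space UNIV)
        (count_space UNIV \<Otimes>\<^sub>M count_space UNIV \<Otimes>\<^sub>M borel \<Otimes>\<^sub>M borel) X1 X2 (\<lambda>\<omega>. (F1 \<omega>, F2 \<omega>, T1 \<omega>, T2 \<omega>)) =
      prob_space.conditional_mutual_information Q b (count_space UNIV) (count_space UNIV) (borel \<Otimes>\<^sub>M borel)
        X1 X2 (\<lambda>\<omega>. (T1 \<omega>, T2 \<omega>)) + t"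
  proof -
    let ?F = "\<lambda>w. snd (snd (snd w))" and ?X1 = "\<lambda>w. fst (fst (snd w))" and ?X2 = "\<lambda>w. snd (fst (snd w))"
    have 1: "cond_pmf_entropy b Q X2 (\<lambda>\<omega>. (F1 \<omega>, F2 \<omega>, T1 \<omega>, T2 \<omega>)) =
        cond_pmf_entropy b W ?X2 (\<lambda>w. (?F w, fst w))"
      unfolding Q_def cond_pmf_entropy_map by (rule cond_pmf_entropy_cong) (auto simp: prod_eq_iff)
    have 2: "cond_pmf_entropy b Q X2 (\<lambda>\<omega>. (X1 \<omega>, F1 \<omega>, F2 \<omega>, T1 \<omega>, T2 \<omega>)) =
        cond_pmf_entropy b W ?X2 (\<lambda>w. (?F w, ?X1 w, fst w))"
      unfolding Q_def cond_pmf_entropy_map by (rule cond_pmf_entropy_cong) (auto simp: prod_eq_iff)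
    have 3: "cond_pmf_entropy b Q X2 (\<lambda>\<omega>. (T1 \<omega>, T2 \<omega>)) = cond_pmf_entropy b W ?X2 fst"
      unfolding Q_def cond_pmf_entropy_map by (rule cond_pmf_entropy_cong) (auto simp: prod_eq_iff)
    have 4: "cond_pmf_entropy b Q X2 (\<lambda>\<omega>. (X1 \<omega>, T1 \<omega>, T2 \<omega>)) = cond_pmf_entropy b W ?X2 (\<lambda>w. (?X1 w, fst w))"
      unfolding Q_def cond_pmf_entropy_map by (rule cond_pmf_entropy_cong) (auto simp: prod_eq_iff)
    have 5: "cond_pmf_entropy b W ?F fst = cond_pmf_entropy b W ?F (\<lambda>w. ((\<lambda>_. ()) (fst (snd w)), fst w))"
      by (rule cond_pmf_entropy_cong) auto
    have 6: "cond_pmf_entropy b W ?F (\<lambda>w. (?X2 w, ?X1 w, fst w)) =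
        cond_pmf_entropy b W ?F (\<lambda>w. (id (fst (snd w)), fst w))"
      by (rule cond_pmf_entropy_cong) (auto simp: prod_eq_iff)
    \<comment> \<open>The swaps replace entropies of x2 given the feedback by entropies of the
      feedback; the entropies of x2 that remain form I(x1; x2 | T).\<close>
    note 7 = cond_entropy_swap[of b W ?X2 ?F fst] cond_entropy_swap[of b W ?X2 ?F "\<lambda>w. (?X1 w, fst w)"]
    have "t = measure_pmf.expectation \<Lambda> (\<lambda>k. input_entropy b ?q snd fst (\<Theta> k)) +
        measure_pmf.expectation \<Lambda> (\<lambda>k. input_entropy b ?q snd snd (\<Theta> k)) -
        measure_pmf.expectation \<Lambda> (\<lambda>k. input_entropy b ?q snd (\<lambda>_. ()) (\<Theta> k)) -
        measure_pmf.expectation \<Lambda> (\<lambda>k. input_entropy b ?q snd id (\<Theta> k))"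
      unfolding t' dependence_gain_def input_entropy_id[symmetric] by simp
    then have "t = cond_pmf_entropy b W ?F (\<lambda>w. (?X1 w, fst w)) + cond_pmf_entropy b W ?F (\<lambda>w. (?X2 w, fst w)) -
        cond_pmf_entropy b W ?F fst - cond_pmf_entropy b W ?F (\<lambda>w. (?X2 w, ?X1 w, fst w))"
      unfolding 5 6 using both[of snd "\<lambda>_. ()"] both[of snd id] both[of snd fst] both[of snd snd] by simp
    with 1 2 3 4 7 show ?thesis
      by (subst (1 2) cmi) (auto intro!: pairs)
  qed
  ultimately have "dependence_balance_constraints b Q borel borel T1 T2 X1 X2 Y F1 F2 R1 R2"
    unfolding dependence_balance_constraints_def using R1 R2 Rs R0 t by simp
  with vars R(2,3) show ?thesis
    unfolding DB_MAC_def by blast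
qed

section \<open>Converse for a code\<close>

text \<open>Used to bound the sum rate of every code, so that Fano's penalty can be
  controlled.\<close>

lemma continuous_functional_bounded_above:
  assumes "continuous_functional f"
  shows "\<exists>C\<ge>0. \<forall>\<theta>. f \<theta> \<le> C"
proof -
  from assms obtain F where F: "continuous_on UNIV F" "\<And>\<theta>. f \<theta> = F (pmf_vec \<theta>)"
    unfolding continuous_functional_def by blast
  have "compact (F ` range pmf_vec)"
    by (intro compact_continuous_image compact_range_pmf_vec continuous_on_subset[OF F(1)]) simp
  from compact_imp_bounded[OF this] obtain C where "\<forall>y\<in>F ` range pmf_vec. norm y \<le> C"
    unfolding bounded_iff ..
  then have C: "\<bar>F (pmf_vec \<theta>)\<bar> \<le> C" for \<theta> by simp
  show ?thesis
  proof (intro exI conjI allI)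
    show "0 \<le> C" using C[of undefined] by linarith
    show "f \<theta> \<le> C" for \<theta> using C[of \<theta>] F(2)[of \<theta>] by linarith
  qed
qed

text \<open>The input entropy is concave in the input law and the noise entropy is linear.\<close>

lemma information_average_le:
  fixes q :: "'x::finite \<Rightarrow> 'z::finite pmf"
  assumes b: "1 < b" and fin: "finite (set_pmf \<Lambda>)"
  shows "measure_pmf.expectation \<Lambda> (\<lambda>t. information b q K L (\<theta> t)) \<le> information b q K L (bind_pmf \<Lambda> \<theta>)"
  using cond_entropy_concave[OF b fin, of \<theta> q K L] noise_entropy_mixture[OF fin, of \<theta> b q K]
  by (simp add: information_def input_entropy_def integrable_measure_pmf_finite[OF fin])

lemma mac_region_mono:
  assumes "(R1, R2) \<in> mac_region b p" "R1' \<le> R1" "R2' \<le> R2"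
  shows "(R1', R2') \<in> mac_region b p"
proof -
  from assms(1) obtain \<theta> s t where
    "(pmf_vec \<theta>, s, t) \<in> mixture_hull (information b (mac_channel p) id (\<lambda>_. ())) (dependence_gain b (mac_channel p) snd)"
    and *: "R1 \<le> information b (mac_channel p) receiver_and_second snd \<theta>"
    "R2 \<le> information b (mac_channel p) receiver_and_first fst \<theta>"
    "R1 + R2 \<le> s" "R1 + R2 \<le> information b (mac_channel p) fst (\<lambda>_. ()) \<theta>" and "0 \<le> t"
    unfolding mac_region_def rate_region_def mem_Collect_eq prod.case by blast
  moreover from * assms(2,3) have "R1' \<le> information b (mac_channel p) receiver_and_second snd \<theta>"
    "R2' \<le> information b (mac_channel p) receiver_and_first fst \<theta>"
    "R1' + R2' \<le> s" "R1' + R2' \<le> information b (mac_channel p) fst (\<lambda>_. ()) \<theta>"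
    by linarith+
  ultimately show ?thesis
    unfolding mac_region_def rate_region_def mem_Collect_eq prod.case by blast
qed

text \<open>State m is the history after m uses and so determines the input at time m + 1; encoders
  count time from 1.\<close>

definition code_inputs :: "('f1, 'x1) encoder \<Rightarrow> ('f2, 'x2) encoder \<Rightarrow> nat \<Rightarrow>
    (nat \<times> nat) \<times> ('y \<times> 'f1 \<times> 'f2) list \<Rightarrow> 'x1 \<times> 'x2" where
  "code_inputs enc1 enc2 m = (\<lambda>((w1, w2), zs).
    (enc1 (Suc m) w1 (map (\<lambda>(y, u, v). u) zs), enc2 (Suc m) w2 (map (\<lambda>(y, u, v). v) zs)))"

lemma fst_code_inputs:
  assumes "fst (fst v) = fst (fst w)" "map (\<lambda>z. fst (snd z)) (snd v) = map (\<lambda>z. fst (snd z)) (snd w)"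
  shows "fst (code_inputs enc1 enc2 m v) = fst (code_inputs enc1 enc2 m w)"
  using assms by (simp add: code_inputs_def case_prod_unfold)

lemma snd_code_inputs:
  assumes "snd (fst v) = snd (fst w)" "map (\<lambda>z. snd (snd z)) (snd v) = map (\<lambda>z. snd (snd z)) (snd w)"
  shows "snd (code_inputs enc1 enc2 m v) = snd (code_inputs enc1 enc2 m w)"
  using assms by (simp add: code_inputs_def case_prod_unfold)

lemma messages_and_outputs_Suc:
  "messages_and_outputs p (Suc m) M1 M2 enc1 enc2 =
    map_pmf (\<lambda>w. (fst (fst w), snd (fst w) @ [snd w]))
      (channel_step (mac_channel p) (messages_and_outputs p m M1 M2 enc1 enc2) (code_inputs enc1 enc2 m))"
  by (simp add: messages_and_outputs_def channel_step_def map_bind_pmf bind_assoc_pmf bind_map_pmf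
      map_pmf_comp case_prod_unfold code_inputs_def mac_channel_def)

lemma messages_and_outputs_0:
  "messages_and_outputs p 0 M1 M2 enc1 enc2 =
    map_pmf (\<lambda>w. (w, [])) (pair_pmf (pmf_of_set {1..M1}) (pmf_of_set {1..M2}))"
  by (simp add: messages_and_outputs_def map_pmf_def case_prod_unfold bind_return_pmf)

lemma channel_process_code:
  fixes p :: "('x1::finite, 'x2::finite, 'y::finite, 'f1::finite, 'f2::finite) mac_gf"
  assumes "1 < b" "1 \<le> M1" "1 \<le> M2"
  shows "channel_process (mac_channel p) (code_inputs enc1 enc2)
    (\<lambda>m. messages_and_outputs p m M1 M2 enc1 enc2) b"
  by unfold_locales (use assms in \<open>auto simp: messages_and_outputs_Suc messages_and_outputs_0\<close>)

text \<open>\<open>\<delta>\<close> is Fano's bound on the remaining message entropy per channel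
  use. One mixture has to serve all constraints at once: its averaged law for three of them, its
  averages for the other two.\<close>

lemma code_rates_in_mac_region:
  fixes p :: "('x1::finite, 'x2::finite, 'y::finite, 'f1::finite, 'f2::finite) mac_gf"
  assumes b: "1 < b" and code: "is_code p n M1 M2 Pe enc1 enc2 dec" and n: "0 < n"
  defines "\<delta> \<equiv> (log b 2 + Pe * log b (real (M1 * M2))) / real n"
  shows "(log b M1 / n - \<delta>, log b M2 / n - \<delta>) \<in> mac_region b p"
proof -
  let ?q = "mac_channel p" and ?X = "code_inputs enc1 enc2" and ?\<Omega> = "\<lambda>m. messages_and_outputs p m M1 M2 enc1 enc2"
  have M: "1 \<le> M1" "1 \<le> M2" using code by (simp_all add: is_code_def)
  interpret channel_process ?q ?X ?\<Omega> b
    by (rule channel_process_code[OF b M])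
  let ?S = "\<lambda>i. channel_step ?q (?\<Omega> i) (?X i)"
  let ?T = "\<lambda>w :: (nat \<times> nat) \<times> ('y \<times> 'f1 \<times> 'f2) list. map snd (snd w)"
  define \<nu> where "\<nu> = (\<lambda>i. map_pmf (?X i) (?\<Omega> i))"
  have "\<exists>\<Theta>. \<forall>i. map_pmf (\<lambda>w. (?T w, ?X i w)) (?\<Omega> i) =
      bind_pmf (map_pmf ?T (?\<Omega> i)) (\<lambda>t. map_pmf (Pair t) (\<Theta> i t))"
  proof (intro choice allI)
    fix i
    obtain \<Theta> where "map_pmf (\<lambda>w. (?T w, ?X i w)) (?\<Omega> i) =
        bind_pmf (map_pmf ?T (?\<Omega> i)) (\<lambda>t. map_pmf (Pair t) (\<Theta> t))"
      by (rule disintegration)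
    then show "\<exists>\<Theta>. map_pmf (\<lambda>w. (?T w, ?X i w)) (?\<Omega> i) =
        bind_pmf (map_pmf ?T (?\<Omega> i)) (\<lambda>t. map_pmf (Pair t) (\<Theta> t))"
      by (rule exI[of _ \<Theta>])
  qed
  then obtain \<Theta> where \<Theta>: "\<And>i. map_pmf (\<lambda>w. (?T w, ?X i w)) (?\<Omega> i) =
      bind_pmf (map_pmf ?T (?\<Omega> i)) (\<lambda>t. map_pmf (Pair t) (\<Theta> i t))" by blast
  define U where "U = pmf_of_set {..<n}"
  have finU: "finite (set_pmf U)" using n by (simp add: U_def lessThan_empty_iff)
  have EU: "measure_pmf.expectation U h = (\<Sum>i<n. h i) / n" for h :: "nat \<Rightarrow> real"
    using n by (simp add: U_def integral_pmf_of_set lessThan_empty_iff)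
  \<comment> \<open>Time sharing: a label pairs a uniform time with the feedback pairs received
    before it.\<close>
  define \<Lambda> where "\<Lambda> = bind_pmf U (\<lambda>i. map_pmf (Pair i) (map_pmf ?T (?\<Omega> i)))"
  have fin\<Lambda>: "finite (set_pmf \<Lambda>)" by (simp add: \<Lambda>_def finU finite_process)
  note [simp] = integrable_measure_pmf_finite[OF fin\<Lambda>]
  have E\<Lambda>: "measure_pmf.expectation \<Lambda> h = (\<Sum>i<n. measure_pmf.expectation (map_pmf ?T (?\<Omega> i)) (\<lambda>t. h (i, t))) / n"
    for h :: "nat \<times> ('f1 \<times> 'f2) list \<Rightarrow> real"
    unfolding \<Lambda>_def EU[symmetric] by (subst expectation_bind_pmf_finite) (simp_all add: finU finite_process)
  have \<nu>: "\<nu> i = bind_pmf (map_pmf ?T (?\<Omega> i)) (\<Theta> i)" for i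
    using arg_cong[OF \<Theta>, of "map_pmf snd" i] by (simp add: \<nu>_def map_pmf_comp map_bind_pmf)
  define \<theta> where "\<theta> = bind_pmf \<Lambda> (\<lambda>(i, t). \<Theta> i t)"
  have \<theta>: "\<theta> = bind_pmf U \<nu>"
    using ext[of \<nu>, OF \<nu>] by (simp add: \<theta>_def \<Lambda>_def bind_assoc_pmf bind_map_pmf)
  have mix: "measure_pmf.expectation \<Lambda> (\<lambda>(i, t). input_entropy b ?q K L (\<Theta> i t)) =
      (\<Sum>i<n. cond_pmf_entropy b (?S i) (\<lambda>w. K (snd w)) (\<lambda>w. (L (?X i (fst w)), ?T (fst w)))) / n"
    for K :: "'y \<times> 'f1 \<times> 'f2 \<Rightarrow> 'k" and L :: "'x1 \<times> 'x2 \<Rightarrow> 'l"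
    unfolding E\<Lambda> input_entropy_def prod.case
    by (intro arg_cong2[where f="(/)"] sum.cong refl cond_entropy_channel_step_mixture[symmetric] \<Theta>)
       (auto simp: finite_process)
  have noise_mix: "measure_pmf.expectation \<Lambda> (\<lambda>(i, t). noise_entropy b ?q K (\<Theta> i t)) = (\<Sum>i<n. noise_entropy b ?q K (\<nu> i)) / n"
    for K :: "'y \<times> 'f1 \<times> 'f2 \<Rightarrow> 'k"
    unfolding E\<Lambda> \<nu> prod.case
    by (intro arg_cong2[where f="(/)"] sum.cong refl noise_entropy_mixture[symmetric]) (auto simp: finite_process)

  have err: "measure_pmf.prob (?\<Omega> n) {w. dec (map fst (snd w)) \<noteq> fst w} = Pe"
    using code by (simp add: is_code_def error_probability_def case_prod_unfold fst_def[symmetric])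
  have start_set: "set_pmf (?\<Omega> 0) \<subseteq> ({1..M1} \<times> {1..M2}) \<times> UNIV"
    using M by (auto simp: messages_and_outputs_0)
  have "fst ` set_pmf (?\<Omega> n) \<subseteq> {1..M1} \<times> {1..M2}"
  proof -
    have "fst ` set_pmf (?\<Omega> n) = fst ` set_pmf (?\<Omega> 0)"
      using arg_cong[OF map_message_process[of "\<lambda>w. w" n], of set_pmf] by simp
    then show ?thesis using start_set by auto
  qed
  then have fano: "cond_pmf_entropy b (?\<Omega> n) fst (\<lambda>w. map fst (snd w)) \<le> n * \<delta>"
    using fano_inequality[OF b finite_process[of n], where W=fst and A="{1..M1} \<times> {1..M2}" and Y="\<lambda>w. map fst (snd w)" and d=dec] n
    by (simp add: err \<delta>_def)

  \<comment> \<open>All four rate bounds follow from this one. \<open>h\<close> is the part of the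
    message revealed to the decoder, \<open>K\<close> what it sees of the outputs, \<open>k\<close>
    recovers Y from that so that Fano applies, and \<open>G\<close> is what remains of the condition
    at each time.\<close>
  have rate: "cond_pmf_entropy b (?\<Omega> 0) fst (\<lambda>w. h (fst w)) / n - \<delta> \<le>
      (\<Sum>i<n. cond_pmf_entropy b (?S i) (\<lambda>w. K (snd w)) (\<lambda>w. G i (fst w)) - noise_entropy b ?q K (\<nu> i)) / n"
    if K: "\<And>z. k (K z) = fst z"
      and G: "\<And>i v w. h (fst v) = h (fst w) \<Longrightarrow> map K (snd v) = map K (snd w) \<Longrightarrow> G i v = G i w"
    for h :: "nat \<times> nat \<Rightarrow> 'h" and K :: "'y \<times> 'f1 \<times> 'f2 \<Rightarrow> 'k" and k and G :: "nat \<Rightarrow> _ \<Rightarrow> 'g"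
  proof -
    have "cond_pmf_entropy b (?\<Omega> n) fst (\<lambda>w. (h (fst w), map K (snd w))) \<le>
        cond_pmf_entropy b (?\<Omega> n) fst (\<lambda>w. map fst (snd w))"
    proof (rule cond_pmf_entropy_le_function[OF b finite_process])
      fix v w :: "(nat \<times> nat) \<times> ('y \<times> 'f1 \<times> 'f2) list"
      assume "(h (fst v), map K (snd v)) = (h (fst w), map K (snd w))"
      then have "map k (map K (snd v)) = map k (map K (snd w))" by simp
      then show "map fst (snd v) = map fst (snd w)" by (simp only: map_map comp_def K)
    qed
    moreover have "cond_pmf_entropy b (?\<Omega> n) fst (\<lambda>w. h (fst w)) -
        cond_pmf_entropy b (?\<Omega> n) fst (\<lambda>w. (h (fst w), map K (snd w))) \<le>
        (\<Sum>i<n. cond_pmf_entropy b (?S i) (\<lambda>w. K (snd w)) (\<lambda>w. G i (fst w)) - noise_entropy b ?q K (\<nu> i))"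
      unfolding \<nu>_def by (rule information_bound) (rule G)
    moreover have "cond_pmf_entropy b (?\<Omega> n) fst (\<lambda>w. h (fst w)) = cond_pmf_entropy b (?\<Omega> 0) fst (\<lambda>w. h (fst w))"
      by (rule cond_entropy_message[of n "\<lambda>w. w"])
    ultimately have "cond_pmf_entropy b (?\<Omega> 0) fst (\<lambda>w. h (fst w)) - n * \<delta> \<le>
        (\<Sum>i<n. cond_pmf_entropy b (?S i) (\<lambda>w. K (snd w)) (\<lambda>w. G i (fst w)) - noise_entropy b ?q K (\<nu> i))"
      using fano by linarith
    from divide_right_mono[OF this, of n] n show ?thesis by (simp add: diff_divide_distrib)
  qed

  let ?pair = "pair_pmf (pmf_of_set {1..M1}) (pmf_of_set {1..M2})"
  have ent_pair: "pmf_entropy b ?pair = log b M1 + log b M2"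
    using M by (simp add: pmf_entropy_pair pmf_entropy_uniform)
  have ent1: "pmf_entropy b (map_pmf (\<lambda>w. fst (fst w)) (?\<Omega> 0)) = log b M1"
    using M by (simp add: messages_and_outputs_0 map_pmf_comp map_fst_pair_pmf pmf_entropy_uniform)
  have ent2: "pmf_entropy b (map_pmf (\<lambda>w. snd (fst w)) (?\<Omega> 0)) = log b M2"
    using M by (simp add: messages_and_outputs_0 map_pmf_comp map_snd_pair_pmf pmf_entropy_uniform)
  have ent12: "pmf_entropy b (map_pmf fst (?\<Omega> 0)) = log b M1 + log b M2"
    using ent_pair by (simp add: messages_and_outputs_0 map_pmf_comp pmf.map_ident)
  have joint: "pmf_entropy b (map_pmf (\<lambda>w. (fst w, h (fst w))) (?\<Omega> 0)) = log b M1 + log b M2"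
    for h :: "nat \<times> nat \<Rightarrow> 'h"
    unfolding ent12[symmetric] by (rule pmf_entropy_map_cong) auto

  have "log b M1 / n - \<delta> \<le> information b ?q receiver_and_second snd \<theta>"
  proof -
    \<comment> \<open>The decoder is given W2 and the feedback of transmitter 2, hence can compute
      x2; H(W | W2) is the first rate. Only x2 stays in the condition, the past feedback is
      dropped.\<close>
    have "log b M1 / n - \<delta> \<le> (\<Sum>i<n. cond_pmf_entropy b (?S i) (\<lambda>w. receiver_and_second (snd w))
        (\<lambda>w. snd (?X i (fst w))) - noise_entropy b ?q receiver_and_second (\<nu> i)) / n"
    proof -
      have G: "snd (?X i v) = snd (?X i w)" if "snd (fst v) = snd (fst w)"
        "map receiver_and_second (snd v) = map receiver_and_second (snd w)" for i v w
        using that(1) arg_cong[OF that(2), of "map snd"]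
        by (intro snd_code_inputs) (simp_all add: comp_def case_prod_unfold)
      have "cond_pmf_entropy b (?\<Omega> 0) fst (\<lambda>w. snd (fst w)) / n - \<delta> \<le>
          (\<Sum>i<n. cond_pmf_entropy b (?S i) (\<lambda>w. receiver_and_second (snd w))
            (\<lambda>w. snd (?X i (fst w))) - noise_entropy b ?q receiver_and_second (\<nu> i)) / n"
        by (rule rate[of fst, OF _ G]) (auto split: prod.split)
      moreover have "cond_pmf_entropy b (?\<Omega> 0) fst (\<lambda>w. snd (fst w)) = log b M1"
        using joint[of snd] ent2 by (simp add: cond_pmf_entropy_def)
      ultimately show ?thesis by simp
    qed
    also have "\<dots> = measure_pmf.expectation U (\<lambda>i. information b ?q receiver_and_second snd (\<nu> i))"
      by (simp add: EU information_def input_entropy_def cond_entropy_channel_step_input \<nu>_def)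
    also have "\<dots> \<le> information b ?q receiver_and_second snd \<theta>"
      unfolding \<theta> by (rule information_average_le[OF b finU])
    finally show ?thesis .
  qed
  moreover have "log b M2 / n - \<delta> \<le> information b ?q receiver_and_first fst \<theta>"
  proof -
    have "log b M2 / n - \<delta> \<le> (\<Sum>i<n. cond_pmf_entropy b (?S i) (\<lambda>w. receiver_and_first (snd w))
        (\<lambda>w. fst (?X i (fst w))) - noise_entropy b ?q receiver_and_first (\<nu> i)) / n"
    proof -
      have G: "fst (?X i v) = fst (?X i w)" if "fst (fst v) = fst (fst w)"
        "map receiver_and_first (snd v) = map receiver_and_first (snd w)" for i v w
        using that(1) arg_cong[OF that(2), of "map snd"]
        by (intro fst_code_inputs) (simp_all add: comp_def case_prod_unfold)
      have "cond_pmf_entropy b (?\<Omega> 0) fst (\<lambda>w. fst (fst w)) / n - \<delta> \<le>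
          (\<Sum>i<n. cond_pmf_entropy b (?S i) (\<lambda>w. receiver_and_first (snd w))
            (\<lambda>w. fst (?X i (fst w))) - noise_entropy b ?q receiver_and_first (\<nu> i)) / n"
        by (rule rate[of fst, OF _ G]) (auto split: prod.split)
      moreover have "cond_pmf_entropy b (?\<Omega> 0) fst (\<lambda>w. fst (fst w)) = log b M2"
        using joint[of fst] ent1 by (simp add: cond_pmf_entropy_def)
      ultimately show ?thesis by simp
    qed
    also have "\<dots> = measure_pmf.expectation U (\<lambda>i. information b ?q receiver_and_first fst (\<nu> i))"
      by (simp add: EU information_def input_entropy_def cond_entropy_channel_step_input \<nu>_def)
    also have "\<dots> \<le> information b ?q receiver_and_first fst \<theta>"
      unfolding \<theta> by (rule information_average_le[OF b finU])
    finally show ?thesis .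
  qed
  moreover have sum_rate: "(log b M1 + log b M2) / n - \<delta> \<le>
      (\<Sum>i<n. cond_pmf_entropy b (?S i) (\<lambda>w. K (snd w)) (\<lambda>w. G i (fst w)) - noise_entropy b ?q K (\<nu> i)) / n"
    if "\<And>z. k (K z) = fst z" "\<And>i v w. map K (snd v) = map K (snd w) \<Longrightarrow> G i v = G i w"
    for K :: "'y \<times> 'f1 \<times> 'f2 \<Rightarrow> 'k" and k and G :: "nat \<Rightarrow> _ \<Rightarrow> 'g"
  proof -
    have "pmf_entropy b (map_pmf (\<lambda>w. ()) (?\<Omega> 0)) = 0" by (simp add: map_pmf_const pmf_entropy_def)
    then have "cond_pmf_entropy b (?\<Omega> 0) fst (\<lambda>w. ()) = log b M1 + log b M2"
      using joint[of "\<lambda>_. ()"] by (simp add: cond_pmf_entropy_def)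
    moreover have "cond_pmf_entropy b (?\<Omega> 0) fst (\<lambda>w. ()) / n - \<delta> \<le>
        (\<Sum>i<n. cond_pmf_entropy b (?S i) (\<lambda>w. K (snd w)) (\<lambda>w. G i (fst w)) - noise_entropy b ?q K (\<nu> i)) / n"
      by (rule rate[of k K "\<lambda>_. ()" G, OF that(1)]) (rule that(2))
    ultimately show ?thesis by simp
  qed
  \<comment> \<open>Fano costs one \<open>\<delta>\<close> in the sum rate while the two lowered
    rates lose two, so the sign of \<open>\<delta>\<close> settles both sum constraints.\<close>
  have \<delta>: "0 \<le> \<delta>"
  proof -
    have "0 \<le> Pe" unfolding err[symmetric] by simp
    moreover have "1 \<le> real (M1 * M2)" using M by (simp add: Suc_le_eq del: of_nat_mult)
    ultimately show ?thesis using b unfolding \<delta>_def by (intro divide_nonneg_nonneg add_nonneg_nonneg mult_nonneg_nonneg) auto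
  qed
  moreover have "(log b M1 / n - \<delta>) + (log b M2 / n - \<delta>) \<le> information b ?q fst (\<lambda>_. ()) \<theta>"
  proof -
    have "(log b M1 + log b M2) / n - \<delta> \<le> (\<Sum>i<n. cond_pmf_entropy b (?S i) (\<lambda>w. fst (snd w))
        (\<lambda>w. ()) - noise_entropy b ?q fst (\<nu> i)) / n"
      by (rule sum_rate[of "\<lambda>x. x" fst "\<lambda>_ _. ()"]) auto
    also have "\<dots> = measure_pmf.expectation U (\<lambda>i. information b ?q fst (\<lambda>_. ()) (\<nu> i))"
    proof -
      have "cond_pmf_entropy b (?S i) (\<lambda>w. fst (snd w)) (\<lambda>w. ()) =
          input_entropy b ?q fst (\<lambda>_. ()) (\<nu> i)" for i
        unfolding input_entropy_def \<nu>_def by (rule cond_entropy_channel_step_input[where L="\<lambda>_. ()"])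
      then show ?thesis by (simp add: EU information_def)
    qed
    also have "\<dots> \<le> information b ?q fst (\<lambda>_. ()) \<theta>"
      unfolding \<theta> by (rule information_average_le[OF b finU])
    finally show ?thesis using \<delta> by (simp add: add_divide_distrib)
  qed
  moreover define s where "s = measure_pmf.expectation \<Lambda> (\<lambda>(i, t). information b ?q id (\<lambda>_. ()) (\<Theta> i t))"
  moreover have "(log b M1 / n - \<delta>) + (log b M2 / n - \<delta>) \<le> s"
  proof -
    \<comment> \<open>All outputs count here and the past feedback stays in the condition, so
      passing to the mixture is an equality instead of a concavity bound.\<close>
    have "(log b M1 + log b M2) / n - \<delta> \<le> (\<Sum>i<n. cond_pmf_entropy b (?S i) (\<lambda>w. id (snd w))
        (\<lambda>w. ((\<lambda>_. ()) (?X i (fst w)), ?T (fst w))) - noise_entropy b ?q id (\<nu> i)) / n"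
      by (rule sum_rate[of fst id "\<lambda>_ w. ((), ?T w)"]) auto
    also have "\<dots> = s"
      unfolding s_def information_def case_prod_unfold
      using mix[of id "\<lambda>_. ()"] noise_mix[of id]
      by (simp add: case_prod_unfold sum_subtractf diff_divide_distrib)
    finally show ?thesis using \<delta> by (simp add: add_divide_distrib)
  qed
  moreover define t where "t = measure_pmf.expectation \<Lambda> (\<lambda>(i, t). dependence_gain b ?q snd (\<Theta> i t))"
  moreover have "0 \<le> t"
  proof -
    have unit: "cond_pmf_entropy b (?S i) (\<lambda>w. snd (snd w)) (\<lambda>w. ?T (fst w)) =
        cond_pmf_entropy b (?S i) (\<lambda>w. snd (snd w)) (\<lambda>w. ((\<lambda>_. ()) (?X i (fst w)), ?T (fst w)))" for i
      by (rule cond_pmf_entropy_cong) auto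
    have X1: "fst (?X i v) = fst (?X i w)" if "fst (fst v) = fst (fst w)" "?T v = ?T w" for i v w
      using that(1) arg_cong[OF that(2), of "map fst"] by (intro fst_code_inputs) (simp_all add: comp_def)
    have X2: "snd (?X i v) = snd (?X i w)" if "snd (fst v) = snd (fst w)" "?T v = ?T w" for i v w
      using that(1) arg_cong[OF that(2), of "map snd"] by (intro snd_code_inputs) (simp_all add: comp_def)
    \<comment> \<open>The observation is the pair of feedbacks, whose past contains what either
      encoder sees. Independence of the messages enters as additivity of their entropies.\<close>
    have "0 \<le> (\<Sum>i<n. cond_pmf_entropy b (?S i) (\<lambda>w. snd (snd w)) (\<lambda>w. (fst (?X i (fst w)), ?T (fst w))) +
      cond_pmf_entropy b (?S i) (\<lambda>w. snd (snd w)) (\<lambda>w. (snd (?X i (fst w)), ?T (fst w))) -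
      cond_pmf_entropy b (?S i) (\<lambda>w. snd (snd w)) (\<lambda>w. ?T (fst w)) - noise_entropy b ?q snd (\<nu> i))"
      unfolding \<nu>_def
    proof (rule dependence_balance[of fst snd])
      show "inj (\<lambda>w. (fst w, snd w))" by simp
    qed (simp only: ent1 ent2 ent12, erule (1) X1, erule (1) X2)
    then have "0 \<le> (\<Sum>i<n. cond_pmf_entropy b (?S i) (\<lambda>w. snd (snd w)) (\<lambda>w. (fst (?X i (fst w)), ?T (fst w))) +
      cond_pmf_entropy b (?S i) (\<lambda>w. snd (snd w)) (\<lambda>w. (snd (?X i (fst w)), ?T (fst w))) -
      cond_pmf_entropy b (?S i) (\<lambda>w. snd (snd w)) (\<lambda>w. ?T (fst w)) - noise_entropy b ?q snd (\<nu> i)) / n"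
      by simp
    also have "\<dots> = t"
      unfolding t_def dependence_gain_def case_prod_unfold unit
      using mix[of snd fst] mix[of snd snd] mix[of snd "\<lambda>_. ()"] noise_mix[of snd]
      by (simp add: case_prod_unfold sum_subtractf sum.distrib diff_divide_distrib add_divide_distrib)
    finally show ?thesis .
  qed
  moreover have "(pmf_vec \<theta>, s, t) \<in> mixture_hull (information b ?q id (\<lambda>_. ())) (dependence_gain b ?q snd)"
    unfolding \<theta>_def s_def t_def case_prod_unfold by (rule mixture_hull_bind[OF fin\<Lambda>])
  ultimately show ?thesis
    unfolding mac_region_def rate_region_def mem_Collect_eq prod.case by blast
qed

text \<open>The term \<open>Pe * l\<close> of the penalty is tamed in two rounds: error at most 1/4
  bounds the sum rate \<open>l\<close> of the code by a constant, and a still smaller error then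
  makes the term itself small.\<close>

lemma achievable_subset_mac_region:
  fixes p :: "('x1::finite, 'x2::finite, 'y::finite, 'f1::finite, 'f2::finite) mac_gf"
  assumes b: "1 < b" and ach: "achievable b p R1 R2"
  shows "(R1, R2) \<in> mac_region b p"
proof -
  let ?q = "mac_channel p"
  obtain C where C: "0 \<le> C" "\<forall>\<theta>. information b ?q fst (\<lambda>_. ()) \<theta> \<le> C"
    using continuous_functional_bounded_above[OF continuous_functional_information[of b ?q fst "\<lambda>_. ()"]] by blast
  have sum_le: "r1 + r2 \<le> C" if "(r1, r2) \<in> mac_region b p" for r1 r2
    using that C(2) unfolding mac_region_def rate_region_def mem_Collect_eq prod.case
    by (meson order_trans)
  have log2: "0 < log b 2" using b by simp
  \<comment> \<open>From \<delta> \<le> log b 2 + l / 4 and l - 2 \<delta> \<le> C follows l / 2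
    \<le> C + 2 log b 2, that is l \<le> B.\<close>
  define B where "B = 2 * C + 4 * log b 2"
  have B: "0 < B" using C(1) log2 by (simp add: B_def)
  have close: "(R1 - e, R2 - e) \<in> mac_region b p" if e: "0 < e" for e
  proof -
    \<comment> \<open>The value 1/4 gives l \<le> B; the other one keeps \<open>Pe * l\<close> below
      e / 2, and the remaining e / 2 is for \<open>log b 2 / n\<close>.\<close>
    define \<epsilon> where "\<epsilon> = min (1 / 4) (e / (2 * B))"
    have \<epsilon>: "0 < \<epsilon>" "\<epsilon> \<le> 1 / 4" "\<epsilon> * B \<le> e / 2"
      using e B by (auto simp: \<epsilon>_def min_def field_simps)
    have "\<forall>\<^sub>F n in sequentially. \<exists>M1 M2 Pe enc1 enc2 dec.
      is_code p n M1 M2 Pe enc1 enc2 dec \<and>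
      R1 \<le> log b (real M1) / real n \<and> R2 \<le> log b (real M2) / real n \<and> Pe \<le> \<epsilon>"
      using ach \<epsilon>(1) unfolding achievable_def by blast
    moreover have "\<forall>\<^sub>F n in sequentially. 0 < n" by (rule eventually_gt_at_top)
    moreover have "\<forall>\<^sub>F n in sequentially. log b 2 / real n < e / 2"
    proof (rule order_tendstoD(2))
      show "(\<lambda>n. log b 2 / real n) \<longlonglongrightarrow> 0" by (rule lim_const_over_n)
    qed (use e in simp)
    ultimately have "\<forall>\<^sub>F n in sequentially. (\<exists>M1 M2 Pe enc1 enc2 dec.
      is_code p n M1 M2 Pe enc1 enc2 dec \<and>
      R1 \<le> log b (real M1) / real n \<and> R2 \<le> log b (real M2) / real n \<and> Pe \<le> \<epsilon>) \<and> 0 < n \<and> log b 2 / real n < e / 2"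
      by eventually_elim auto
    from eventually_happens'[OF sequentially_bot this] obtain n M1 M2 Pe enc1 enc2 dec where code: "is_code p n M1 M2 Pe enc1 enc2 dec"
      and R: "R1 \<le> log b (real M1) / real n" "R2 \<le> log b (real M2) / real n" and Pe: "Pe \<le> \<epsilon>"
      and n: "0 < n" "log b 2 / real n < e / 2"
      by blast
    define l where "l = log b (real (M1 * M2)) / n"
    define \<delta> where "\<delta> = (log b 2 + Pe * log b (real (M1 * M2))) / real n"
    have M: "1 \<le> M1" "1 \<le> M2" using code by (simp_all add: is_code_def)
    have l: "l = log b M1 / n + log b M2 / n"
      using M by (simp add: l_def log_mult add_divide_distrib)
    have "0 \<le> l" using b M by (simp add: l divide_nonneg_nonneg add_nonneg_nonneg)
    have \<delta>: "\<delta> = log b 2 / n + Pe * l" by (simp add: \<delta>_def l_def add_divide_distrib)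
    have mem: "(log b M1 / n - \<delta>, log b M2 / n - \<delta>) \<in> mac_region b p"
      unfolding \<delta>_def by (rule code_rates_in_mac_region[OF b code n(1)])
    have "l - 2 * \<delta> \<le> C" using sum_le[OF mem] by (simp add: l)
    moreover have "Pe * l \<le> 1 / 4 * l"
      using Pe \<epsilon>(2) \<open>0 \<le> l\<close> by (intro mult_right_mono) auto
    moreover have "log b 2 / n \<le> log b 2"
      using log2 n(1) by (simp add: divide_le_eq)
    ultimately have "\<delta> \<le> log b 2 + l / 4" "l - 2 * \<delta> \<le> C" unfolding \<delta> by simp_all
    then have "l \<le> B" unfolding B_def by linarith
    then have "Pe * l \<le> \<epsilon> * B"
      using Pe \<epsilon>(1) \<open>0 \<le> l\<close> by (meson less_imp_le mult_left_mono mult_right_mono order_trans)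
    then have "\<delta> \<le> e" unfolding \<delta> using \<epsilon>(3) n(2) by linarith
    \<comment> \<open>The lowered rates may be negative, which \<open>mac_region\<close>
      permits.\<close>
    then show ?thesis
      using mac_region_mono[OF mem, of "R1 - e" "R2 - e"] R by linarith
  qed
  show ?thesis
  proof (rule closed_sequentially[OF closed_mac_region])
    show "(R1 - 1 / real (Suc k), R2 - 1 / real (Suc k)) \<in> mac_region b p" for k
      by (rule close) simp
    have "(\<lambda>k. 1 / real (Suc k)) \<longlonglongrightarrow> 0"
      by (rule LIMSEQ_Suc[OF lim_1_over_n])
    then have "(\<lambda>k. (R1 - 1 / real (Suc k), R2 - 1 / real (Suc k))) \<longlonglongrightarrow> (R1 - 0, R2 - 0)"
      by (intro tendsto_intros)
    then show "(\<lambda>k. (R1 - 1 / real (Suc k), R2 - 1 / real (Suc k))) \<longlonglongrightarrow> (R1, R2)"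
      by simp
  qed
qed

theorem theorem1:
  fixes p :: "('x1::finite, 'x2::finite, 'y::finite, 'f1::finite, 'f2::finite) mac_gf"
    and b :: real
  assumes "1 < b"
  shows "capacity_region b p \<subseteq> DB_MAC b p"
proof -
  \<comment> \<open>The quadrant restores the sign conditions that \<open>mac_region\<close> omits
    and keeps the set closed.\<close>
  let ?R = "mac_region b p \<inter> {0..} \<times> {0..}"
  have "{(R1, R2). achievable b p R1 R2} \<subseteq> ?R"
    using achievable_subset_mac_region[OF assms] by (auto simp: achievable_def)
  moreover have "closed ?R"
    by (intro closed_Int closed_mac_region closed_Times closed_atLeast)
  ultimately have "capacity_region b p \<subseteq> ?R"
    unfolding capacity_region_def by (rule closure_minimal)
  also have "\<dots> \<subseteq> DB_MAC b p"
    using mac_region_subset_DB_MAC[OF assms] by auto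
  finally show ?thesis .
qed

end
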